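(* Let $N$ be a smooth manifold with $\dim N\ge 2$ and let $T^*N$ be its cotangent bundle with its canonical symplectic form. Then there is no $C^{-1}$ bi-invariant metric on the group $\mathcal{H}(T^*N)$ of Hamiltonian diffeomorphisms of $T^*N$.
   Context: For a smooth function $H$ on a symplectic manifold $(M,\omega)$, $X_H$ is defined by $dH=\iota_{X_H}\omega$. For a smooth path of functions $H=(H_t)_{t\in[0,1]}$, $H_t\in C^\infty(M)$ (no assumption on supports), $\phi_H^t$ denotes the flow generated by $X_{H_t}$, when it exists, and $\phi_H=\phi_H^1$. $\mathit{Ham}$ is the set of such $H$ whose flow exists (as diffeomorphisms of $M$ for all $t\in[0,1]$), $\Phi:\mathit{Ham}\to\mathrm{Diff}(M)$ is $\Phi(H)=\phi_H^1$, and $\mathcal{H}(M)=\Phi(\mathit{Ham})$ is the group of Hamiltonian diffeomorphisms. A bi-invariant metric on a subgroup $\mathcal{G}\subset\mathcal{H}(M)$ is a distance $d$ on $\mathcal{G}$ with $d(\phi,\psi)=d(\phi\chi,\psi\chi)=d(\chi\phi,\chi\psi)$ for all $\phi,\psi,\chi\in\mathcal{G}$. It is $C^{-1}$ if $(H,K)\mapsto d(\Phi(H),\Phi(K))$ is continuous on $\Phi^{-1}(\mathcal{G})\times\Phi^{-1}(\mathcal{G})$, where $\Phi^{-1}(\mathcal{G})\subset\mathit{Ham}$ carries the compact-open topology (uniform convergence on compact sets). *)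

theory Defs
  imports "HOL-Analysis.Analysis"
begin

section \<open>Smooth functions on Euclidean spaces\<close>

text \<open>\<open>Ck_on k S f\<close> is meant for open \<open>S\<close>.\<close>

primrec Ck_on ::
  "nat \<Rightarrow> 'a::euclidean_space set \<Rightarrow> ('a \<Rightarrow> 'b::euclidean_space) \<Rightarrow> bool" where
  "Ck_on 0 S f \<longleftrightarrow> continuous_on S f"
| "Ck_on (Suc k) S f \<longleftrightarrow>
     (\<forall>x\<in>S. f differentiable (at x)) \<and>
     (\<forall>v. Ck_on k S (\<lambda>x. frechet_derivative f (at x) v))"

text \<open>For an arbitrary set \<open>S\<close>, smoothness means that there are local smooth extensions.
  Non-open sets only occur as \<open>[0,1] \<times> V\<close>, with \<open>V\<close> open.\<close>

definition smooth_on ::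
  "'a::euclidean_space set \<Rightarrow> ('a \<Rightarrow> 'b::euclidean_space) \<Rightarrow> bool" where
  "smooth_on S f \<longleftrightarrow>
     (\<forall>x\<in>S. \<exists>W g. open W \<and> x \<in> W \<and> (\<forall>k. Ck_on k W g) \<and> (\<forall>y\<in>S \<inter> W. g y = f y))"

section \<open>Smooth manifolds\<close>

text \<open>A chart is a pair \<open>(U, \<phi>)\<close>; the values of \<open>\<phi>\<close> outside \<open>U\<close> are irrelevant.\<close>

type_synonym ('a, 'e) chart = "'a set \<times> ('a \<Rightarrow> 'e)"

record ('a, 'e) mfd =
  mtop :: "'a topology"
  atlas :: "('a, 'e) chart set"

abbreviation pts :: "('a, 'e) mfd \<Rightarrow> 'a set" where
  "pts M \<equiv> topspace (mtop M)"

definition cinv :: "('a, 'e) chart \<Rightarrow> 'e \<Rightarrow> 'a" where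
  "cinv c = inv_into (fst c) (snd c)"

definition smooth_manifold :: "('a, 'e::euclidean_space) mfd \<Rightarrow> bool" where
  "smooth_manifold M \<longleftrightarrow>
     Hausdorff_space (mtop M) \<and> second_countable (mtop M) \<and>
     (\<Union>c\<in>atlas M. fst c) = pts M \<and>
     (\<forall>c\<in>atlas M. openin (mtop M) (fst c) \<and> open (snd c ` fst c) \<and>
        homeomorphic_map (subtopology (mtop M) (fst c)) (top_of_set (snd c ` fst c)) (snd c)) \<and>
     (\<forall>c\<in>atlas M. \<forall>c'\<in>atlas M. smooth_on (snd c ` (fst c \<inter> fst c')) (snd c' \<circ> cinv c))"

definition charts_at :: "('a, 'e) mfd \<Rightarrow> 'a \<Rightarrow> ('a, 'e) chart set" where
  "charts_at M x = {c \<in> atlas M. x \<in> fst c}"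

definition chart_at :: "('a, 'e) mfd \<Rightarrow> 'a \<Rightarrow> ('a, 'e) chart" where
  "chart_at M x = (SOME c. c \<in> charts_at M x)"

definition smooth_map ::
  "('a, 'e::euclidean_space) mfd \<Rightarrow> ('b, 'f::euclidean_space) mfd \<Rightarrow> ('a \<Rightarrow> 'b) \<Rightarrow> bool" where
  "smooth_map M N F \<longleftrightarrow> continuous_map (mtop M) (mtop N) F \<and>
     (\<forall>c\<in>atlas M. \<forall>c'\<in>atlas N.
        smooth_on (snd c ` (fst c \<inter> F -` fst c')) (snd c' \<circ> F \<circ> cinv c))"

text \<open>A diffeomorphism is represented by its extension by the identity to the ambient type, so
  that distinct diffeomorphisms are distinct functions and composition is \<open>\<circ>\<close>.\<close>

definition diffeo :: "('a, 'e::euclidean_space) mfd \<Rightarrow> ('a \<Rightarrow> 'a) \<Rightarrow> bool" where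
  "diffeo M F \<longleftrightarrow> bij_betw F (pts M) (pts M) \<and> smooth_map M M F \<and>
     smooth_map M M (inv_into (pts M) F) \<and> (\<forall>x. x \<notin> pts M \<longrightarrow> F x = x)"

section \<open>Tangent vectors and forms\<close>

text \<open>A tangent vector at \<open>x\<close> is a family of coordinate vectors, indexed by the charts around
  \<open>x\<close>, which transforms by the derivatives of the transition maps. The family is extended by \<open>0\<close>
  to all other pairs \<open>(U, \<phi>)\<close>; vector space operations are pointwise.\<close>

type_synonym ('a, 'e) tvec = "('a, 'e) chart \<Rightarrow> 'e"

definition tangent_space :: "('a, 'e::euclidean_space) mfd \<Rightarrow> 'a \<Rightarrow> ('a, 'e) tvec set" where
  "tangent_space M x = {v.
     (\<forall>c\<in>charts_at M x. \<forall>c'\<in>charts_at M x.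
        v c' = frechet_derivative (snd c' \<circ> cinv c) (at (snd c x)) (v c)) \<and>
     (\<forall>c. c \<notin> charts_at M x \<longrightarrow> v c = 0)}"

text \<open>The tangent vector at \<open>x\<close> whose coordinates in the chart \<open>c\<close> are \<open>a\<close>.\<close>

definition coord_vec ::
  "('a, 'e::euclidean_space) mfd \<Rightarrow> ('a, 'e) chart \<Rightarrow> 'a \<Rightarrow> 'e \<Rightarrow> ('a, 'e) tvec" where
  "coord_vec M c x a = (\<lambda>c'. if c' \<in> charts_at M x
     then frechet_derivative (snd c' \<circ> cinv c) (at (snd c x)) a else 0)"

text \<open>The operators below are computed in the chart \<open>chart_at\<close>; they do not depend on this
  choice when applied to smooth objects and to elements of the tangent spaces.\<close>

definition tangent_map ::
  "('a, 'e::euclidean_space) mfd \<Rightarrow> ('b, 'f::euclidean_space) mfd \<Rightarrow> ('a \<Rightarrow> 'b) \<Rightarrow>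
   'a \<Rightarrow> ('a, 'e) tvec \<Rightarrow> ('b, 'f) tvec" where
  "tangent_map M N F x v = (let c = chart_at M x in
     (\<lambda>c'. if c' \<in> charts_at N (F x)
       then frechet_derivative (snd c' \<circ> F \<circ> cinv c) (at (snd c x)) (v c) else 0))"

definition differential ::
  "('a, 'e::euclidean_space) mfd \<Rightarrow> ('a \<Rightarrow> real) \<Rightarrow> 'a \<Rightarrow> ('a, 'e) tvec \<Rightarrow> real" where
  "differential M h x v = (let c = chart_at M x in
     frechet_derivative (h \<circ> cinv c) (at (snd c x)) (v c))"

type_synonym ('a, 'e) one_form = "'a \<Rightarrow> ('a, 'e) tvec \<Rightarrow> real"
type_synonym ('a, 'e) two_form = "'a \<Rightarrow> ('a, 'e) tvec \<Rightarrow> ('a, 'e) tvec \<Rightarrow> real"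

text \<open>In coordinates, \<open>d\<theta>(v, w) = \<partial>\<^sub>v(\<theta>(w)) - \<partial>\<^sub>w(\<theta>(v))\<close> where \<open>v\<close> and \<open>w\<close> are extended as constant
  vector fields.\<close>

definition exterior_derivative ::
  "('a, 'e::euclidean_space) mfd \<Rightarrow> ('a, 'e) one_form \<Rightarrow> ('a, 'e) two_form" where
  "exterior_derivative M \<theta> x v w = (let c = chart_at M x;
       \<theta>\<^sub>c = (\<lambda>a y. \<theta> (cinv c y) (coord_vec M c (cinv c y) a))
     in frechet_derivative (\<theta>\<^sub>c (w c)) (at (snd c x)) (v c)
      - frechet_derivative (\<theta>\<^sub>c (v c)) (at (snd c x)) (w c))"

section \<open>The cotangent bundle\<close>

definition cotangent_space ::
  "('a, 'e::euclidean_space) mfd \<Rightarrow> 'a \<Rightarrow> (('a, 'e) tvec \<Rightarrow> real) set" where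
  "cotangent_space N q = {\<alpha>.
     (\<forall>v\<in>tangent_space N q. \<forall>w\<in>tangent_space N q. \<alpha> (\<lambda>c. v c + w c) = \<alpha> v + \<alpha> w) \<and>
     (\<forall>r. \<forall>v\<in>tangent_space N q. \<alpha> (\<lambda>c. r *\<^sub>R v c) = r * \<alpha> v) \<and>
     (\<forall>v. v \<notin> tangent_space N q \<longrightarrow> \<alpha> v = 0)}"

type_synonym ('a, 'e) cotan = "'a \<times> (('a, 'e) tvec \<Rightarrow> real)"

text \<open>The chart \<open>(q, \<alpha>) \<mapsto> (\<phi>(q), p)\<close> of \<open>T\<^sup>*N\<close> induced by a chart \<open>(U, \<phi>)\<close> of \<open>N\<close>, where the
  coordinates of \<open>p\<close> are \<open>p\<^sub>b = \<alpha>(\<partial>\<^sub>b)\<close>.\<close>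

definition cotangent_chart ::
  "('a, 'e::euclidean_space) mfd \<Rightarrow> ('a, 'e) chart \<Rightarrow> (('a, 'e) cotan, 'e \<times> 'e) chart" where
  "cotangent_chart N c =
     (Sigma (fst c) (cotangent_space N),
      \<lambda>(q, \<alpha>). (snd c q, \<Sum>b\<in>Basis. \<alpha> (coord_vec N c q b) *\<^sub>R b))"

definition cotangent_bundle ::
  "('a, 'e::euclidean_space) mfd \<Rightarrow> (('a, 'e) cotan, 'e \<times> 'e) mfd" where
  "cotangent_bundle N = \<lparr>
     mtop = topology_generated_by
       {{z \<in> fst c. snd c z \<in> W} | c W. c \<in> cotangent_chart N ` atlas N \<and> open W},
     atlas = cotangent_chart N ` atlas N\<rparr>"

definition liouville_form ::
  "('a, 'e::euclidean_space) mfd \<Rightarrow> (('a, 'e) cotan, 'e \<times> 'e) one_form" where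
  "liouville_form N z v = snd z (tangent_map (cotangent_bundle N) N fst z v)"

text \<open>The sign is such that \<open>\<omega> = \<Sum> dq\<^sub>i \<and> dp\<^sub>i\<close>. The opposite sign would replace the flow of
  \<open>H\<close> by the flow of \<open>-H\<close>.\<close>

definition canonical_symplectic_form ::
  "('a, 'e::euclidean_space) mfd \<Rightarrow> (('a, 'e) cotan, 'e \<times> 'e) two_form" where
  "canonical_symplectic_form N z v w =
     - exterior_derivative (cotangent_bundle N) (liouville_form N) z v w"

section \<open>Hamiltonian diffeomorphisms\<close>

text \<open>The Hamiltonian vector field \<open>X\<^sub>h\<close>: \<open>dh = \<iota>\<^bsub>X\<^sub>h\<^esub> \<omega> = \<omega>(X\<^sub>h, \<cdot>)\<close>.\<close>

definition ham_vf ::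
  "('a, 'e::euclidean_space) mfd \<Rightarrow> ('a, 'e) two_form \<Rightarrow> ('a \<Rightarrow> real) \<Rightarrow> 'a \<Rightarrow> ('a, 'e) tvec" where
  "ham_vf M \<omega> h x = (THE v. v \<in> tangent_space M x \<and>
     (\<forall>w\<in>tangent_space M x. differential M h x w = \<omega> x v w))"

definition smooth_path :: "('a, 'e::euclidean_space) mfd \<Rightarrow> (real \<Rightarrow> 'a \<Rightarrow> real) \<Rightarrow> bool" where
  "smooth_path M H \<longleftrightarrow>
     (\<forall>c\<in>atlas M. smooth_on ({0..1} \<times> snd c ` fst c) (\<lambda>(t, y). H t (cinv c y)))"

text \<open>\<open>\<phi>\<close> is the flow of \<open>X\<^bsub>H t\<^esub>\<close> for times in \<open>[0,1]\<close>; its values at other times are arbitrary.\<close>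

definition is_ham_flow ::
  "('a, 'e::euclidean_space) mfd \<Rightarrow> ('a, 'e) two_form \<Rightarrow> (real \<Rightarrow> 'a \<Rightarrow> real) \<Rightarrow>
   (real \<Rightarrow> 'a \<Rightarrow> 'a) \<Rightarrow> bool" where
  "is_ham_flow M \<omega> H \<phi> \<longleftrightarrow>
     (\<forall>t\<in>{0..1}. diffeo M (\<phi> t)) \<and> (\<forall>x\<in>pts M. \<phi> 0 x = x) \<and>
     (\<forall>x\<in>pts M. continuous_map (top_of_set {0..1}) (mtop M) (\<lambda>t. \<phi> t x) \<and>
       (\<forall>t\<in>{0..1}. \<forall>c\<in>charts_at M (\<phi> t x).
         ((\<lambda>s. snd c (\<phi> s x)) has_vector_derivative ham_vf M \<omega> (H t) (\<phi> t x) c)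
           (at t within {0..1})))"

definition Ham :: "('a, 'e::euclidean_space) mfd \<Rightarrow> ('a, 'e) two_form \<Rightarrow> (real \<Rightarrow> 'a \<Rightarrow> real) set" where
  "Ham M \<omega> = {H. smooth_path M H \<and> (\<exists>\<phi>. is_ham_flow M \<omega> H \<phi>)}"

text \<open>The time-one map of the flow.\<close>

definition ham_map ::
  "('a, 'e::euclidean_space) mfd \<Rightarrow> ('a, 'e) two_form \<Rightarrow> (real \<Rightarrow> 'a \<Rightarrow> real) \<Rightarrow> 'a \<Rightarrow> 'a" where
  "ham_map M \<omega> H = (THE \<psi>. \<exists>\<phi>. is_ham_flow M \<omega> H \<phi> \<and> \<phi> 1 = \<psi>)"

definition ham_diffeos ::
  "('a, 'e::euclidean_space) mfd \<Rightarrow> ('a, 'e) two_form \<Rightarrow> ('a \<Rightarrow> 'a) set" where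
  "ham_diffeos M \<omega> = ham_map M \<omega> ` Ham M \<omega>"

section \<open>Bi-invariant metrics\<close>

definition bi_invariant_metric :: "('a \<Rightarrow> 'a) set \<Rightarrow> (('a \<Rightarrow> 'a) \<Rightarrow> ('a \<Rightarrow> 'a) \<Rightarrow> real) \<Rightarrow> bool" where
  "bi_invariant_metric G d \<longleftrightarrow> Metric_space G d \<and>
     (\<forall>\<phi>\<in>G. \<forall>\<psi>\<in>G. \<forall>\<eta>\<in>G.
        d \<phi> \<psi> = d (\<phi> \<circ> \<eta>) (\<psi> \<circ> \<eta>) \<and> d \<phi> \<psi> = d (\<eta> \<circ> \<phi>) (\<eta> \<circ> \<psi>))"

text \<open>The compact-open topology on \<open>Ham\<close>, its elements being viewed as functions on
  \<open>[0,1] \<times> M\<close>.\<close>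

definition ham_topology ::
  "('a, 'e::euclidean_space) mfd \<Rightarrow> ('a, 'e) two_form \<Rightarrow> (real \<Rightarrow> 'a \<Rightarrow> real) topology" where
  "ham_topology M \<omega> = topology_generated_by
     {{H \<in> Ham M \<omega>. \<forall>(t, x)\<in>K. H t x \<in> V} | K V.
        compactin (prod_topology (top_of_set {0..1}) (mtop M)) K \<and> open V}"

definition C_minus_1 ::
  "('a, 'e::euclidean_space) mfd \<Rightarrow> ('a, 'e) two_form \<Rightarrow> ('a \<Rightarrow> 'a) set \<Rightarrow>
   (('a \<Rightarrow> 'a) \<Rightarrow> ('a \<Rightarrow> 'a) \<Rightarrow> real) \<Rightarrow> bool" where
  "C_minus_1 M \<omega> G d \<longleftrightarrow>
     (let T = subtopology (ham_topology M \<omega>) {H \<in> Ham M \<omega>. ham_map M \<omega> H \<in> G} in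
      continuous_map (prod_topology T T) euclideanreal
        (\<lambda>(H, K). d (ham_map M \<omega> H) (ham_map M \<omega> K)))"

end

theory Submission
  imports Defs
begin

text \<open>Let \<open>\<phi>\<close> be the time-one map of a Hamiltonian supported in a small ball in a cotangent chart,
  and let \<open>\<eta>\<^sub>n\<close> be the fibrewise translation by \<open>n df\<close>, the time-one map of \<open>- n f\<close>, where \<open>df\<close> is a
  nonzero constant covector near the centre of the ball. Conjugation by \<open>\<eta>\<^sub>n\<close> moves the support of
  the Hamiltonian out of every compact set, so the conjugated Hamiltonians tend to \<open>0\<close> in the
  compact-open topology, whereas bi-invariance keeps their distance to the identity constant.
  Hence a \<open>C\<^sup>-\<^sup>1\<close> metric would give \<open>d(id, \<phi>) = 0\<close>.

  Radial Hamiltonians are chosen because their flow is an explicit rotation, and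
  on their support \<open>\<eta>\<^sub>n\<close> is a translation, so that the conjugates are again radial. No
  existence theorem for flows is needed.\<close>

section \<open>Calculus of smooth functions\<close>

text \<open>Two features of the definitions shape the work. \<open>ham_map\<close> is a definite
  description, so besides exhibiting a flow one has to show that every flow of the same Hamiltonian
  has the same time-one map. For an autonomous Hamiltonian whose flow \<open>\<Psi>\<close> is an
  explicit group this follows by transporting an arbitrary integral curve back along
  \<open>\<Psi> (- t)\<close>. Moreover the forms are defined through chosen charts and families of
  coordinate vectors, so Hamilton's equations have to be derived in every cotangent chart; the
  essential input is the symmetry of second derivatives. All Hamiltonians live over a compact ball
  in one chart of the base. The image of a cotangent chart is a full product with the momentum
  space, so a support can be pushed along the fibres as far as desired without leaving the chart,
  and maps of \<open>'e \<times> 'e\<close> that are trivial off the ball extend by the identity.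
  The sign in - n f comes from the equation p' = - dH/dq.\<close>

definition Cinf :: "'a::euclidean_space set \<Rightarrow> ('a \<Rightarrow> 'b::euclidean_space) \<Rightarrow> bool" where
  "Cinf S f \<longleftrightarrow> (\<forall>k. Ck_on k S f)"

lemma Ck_on_continuous_on: "Ck_on k S f \<Longrightarrow> continuous_on S f"
  by (cases k) (auto intro!: continuous_at_imp_continuous_on differentiable_imp_continuous_within)

text \<open>The recursion only mentions derivatives, so descending one order takes an induction
  whose base case is the continuity of a differentiable function.\<close>

lemma Ck_on_SucD: "Ck_on (Suc k) S f \<Longrightarrow> Ck_on k S f"
proof (induction k arbitrary: f)
  case 0
  then show ?case using Ck_on_continuous_on by fastforce
next
  case (Suc k)
  then show ?case by (metis Ck_on.simps(2))
qed

text \<open>On an open set, equal values near a point force equal derivatives there, so the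
  agreement passes to every order.\<close>

lemma Ck_on_cong:
  assumes "open S" "\<And>x. x \<in> S \<Longrightarrow> f x = g x" "Ck_on k S f"
  shows "Ck_on k S g"
  using assms
proof (induction k arbitrary: f g)
  case 0
  then show ?case by (metis Ck_on.simps(1) continuous_on_cong)
next
  case (Suc k)
  have eq: "frechet_derivative f (at x) = frechet_derivative g (at x)" "g differentiable (at x)"
    if "x \<in> S" for x
  proof -
    have d: "f differentiable (at x)" using Suc that by auto
    show "frechet_derivative f (at x) = frechet_derivative g (at x)"
      by (rule frechet_derivative_transform_within_open[OF d Suc.prems(1) that]) (use Suc in auto)
    show "g differentiable (at x)"
      using d Suc.prems(1,2) that unfolding differentiable_def
      by (metis has_derivative_transform_within_open)
  qed
  have "Ck_on k S (\<lambda>x. frechet_derivative g (at x) v)" for v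
    by (rule Suc.IH[of "\<lambda>x. frechet_derivative f (at x) v"]) (use Suc eq in auto)
  then show ?case using eq by auto
qed

lemma Ck_on_subset: "Ck_on k S f \<Longrightarrow> T \<subseteq> S \<Longrightarrow> Ck_on k T f"
  by (induction k arbitrary: f) (auto intro: continuous_on_subset)

lemma Ck_on_local:
  assumes "\<And>x. x \<in> S \<Longrightarrow> \<exists>W. open W \<and> x \<in> W \<and> Ck_on k W f"
  shows "Ck_on k S f"
  using assms
proof (induction k arbitrary: f)
  case 0
  have "isCont f x" if "x \<in> S" for x
    using 0[OF that] by (metis Ck_on.simps(1) continuous_on_eq_continuous_at)
  then show ?case by (simp add: continuous_at_imp_continuous_on)
next
  case (Suc k)
  have "f differentiable (at x)" if "x \<in> S" for x
    using Suc.prems[OF that] by auto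
  moreover have "Ck_on k S (\<lambda>x. frechet_derivative f (at x) v)" for v
    by (rule Suc.IH) (metis Ck_on.simps(2) Suc.prems)
  ultimately show ?case by simp
qed

text \<open>Lets the closure proofs work with an explicit derivative \<open>D\<close> in place of
  the choice made by \<open>frechet_derivative\<close>.\<close>

lemma Ck_on_SucI:
  assumes "open S" "\<And>x. x \<in> S \<Longrightarrow> (f has_derivative D x) (at x)"
    "\<And>v. Ck_on k S (\<lambda>x. D x v)"
  shows "Ck_on (Suc k) S f"
proof -
  have eq: "D x = frechet_derivative f (at x)" if "x \<in> S" for x
    using assms(2)[OF that] by (rule frechet_derivative_at)
  have "Ck_on k S (\<lambda>x. frechet_derivative f (at x) v)" for v
    by (rule Ck_on_cong[OF assms(1) _ assms(3)[of v]]) (simp add: eq)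
  then show ?thesis using differentiableI[OF assms(2)] by auto
qed

lemma Ck_on_has_derivative:
  assumes "Ck_on (Suc k) S f" "x \<in> S"
  shows "(f has_derivative frechet_derivative f (at x)) (at x)"
  using assms frechet_derivative_works by auto

section \<open>Closure properties of functions of class C^k\<close>

lemma Ck_on_const: "open S \<Longrightarrow> Ck_on k S (\<lambda>x. c)"
proof (induction k arbitrary: c)
  case (Suc k)
  then show ?case by (intro Ck_on_SucI[where D="\<lambda>x v. 0"]) auto
qed simp

lemma Ck_on_linear:
  assumes "bounded_linear L" "open S"
  shows "Ck_on k S L"
proof (cases k)
  case 0
  then show ?thesis using assms linear_continuous_on by auto
next
  case (Suc n)
  show ?thesis
    unfolding Suc
    by (rule Ck_on_SucI[where D="\<lambda>x. L"]; intro Ck_on_const bounded_linear_imp_has_derivative assms)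
qed

lemma Ck_on_add:
  assumes "open S" "Ck_on k S f" "Ck_on k S g"
  shows "Ck_on k S (\<lambda>x. f x + g x)"
  using assms(2,3)
proof (induction k arbitrary: f g)
  case (Suc k)
  show ?case
    by (rule Ck_on_SucI[OF assms(1),
          where D="\<lambda>x v. frechet_derivative f (at x) v + frechet_derivative g (at x) v"])
      (use Suc in \<open>auto intro!: has_derivative_add Ck_on_has_derivative[of k S]\<close>)
qed (auto intro: continuous_on_add)

lemma Ck_on_sum:
  assumes "open S" "\<And>i. i \<in> I \<Longrightarrow> Ck_on k S (f i)"
  shows "Ck_on k S (\<lambda>x. \<Sum>i\<in>I. f i x)"
proof (cases "finite I")
  case True
  from True assms(2) show ?thesis
    by (induction) (auto intro!: Ck_on_const Ck_on_add assms(1))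
qed (auto intro: Ck_on_const assms)

text \<open>Both terms of the product rule again have the form \<open>B _ _\<close> with factors of
  one order less, so a single induction covers scalar multiples, inner products and
  products.\<close>

lemma Ck_on_bilinear:
  assumes "bounded_bilinear B" "open S" "Ck_on k S f" "Ck_on k S g"
  shows "Ck_on k S (\<lambda>x. B (f x) (g x))"
  using assms(3,4)
proof (induction k arbitrary: f g)
  case 0
  then show ?case by (auto intro: bounded_bilinear.continuous_on[OF assms(1)])
next
  case (Suc k)
  show ?case
    by (rule Ck_on_SucI[OF assms(2),
          where D="\<lambda>x v. B (f x) (frechet_derivative g (at x) v) + B (frechet_derivative f (at x) v) (g x)"])
      (use Suc in \<open>auto intro!: bounded_bilinear.FDERIV[OF assms(1)] Ck_on_add assms(2) Suc.IH
         Ck_on_has_derivative[of k S] intro: Ck_on_SucD\<close>)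
qed

lemma linear_expand_Basis:
  fixes x :: "'a::euclidean_space"
  assumes "linear L"
  shows "L x = (\<Sum>b\<in>Basis. (x \<bullet> b) *\<^sub>R L b)"
  by (metis (no_types, lifting) assms euclidean_representation linear_sum linear_scale sum.cong)

text \<open>In the chain rule the direction fed to the derivative of \<open>g\<close> varies with
  the point. Expanding it in \<open>Basis\<close> leaves products of coefficients with derivatives
  of \<open>g\<close> in fixed directions, to which the induction hypothesis applies.\<close>

lemma Ck_on_compose:
  assumes "open S" "open T" "f ` S \<subseteq> T" "Ck_on k S f" "Ck_on k T g"
  shows "Ck_on k S (\<lambda>x. g (f x))"
  using assms(4,5)
proof (induction k arbitrary: g)
  case 0
  then show ?case using assms(3) by (auto intro: continuous_on_compose2)
next
  case (Suc k)
  note f = Ck_on_has_derivative[OF Suc.prems(1)]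
  have g: "(g has_derivative frechet_derivative g (at (f x))) (at (f x))" if "x \<in> S" for x
    using Ck_on_has_derivative[OF Suc.prems(2)] that assms(3) by blast
  show ?case
  proof (rule Ck_on_SucI[OF assms(1),
          where D="\<lambda>x v. frechet_derivative g (at (f x)) (frechet_derivative f (at x) v)"])
    show "((\<lambda>x. g (f x)) has_derivative
            (\<lambda>v. frechet_derivative g (at (f x)) (frechet_derivative f (at x) v))) (at x)"
      if "x \<in> S" for x
      using has_derivative_compose[OF f[OF that] g[OF that]] .
    fix v
    have "Ck_on k S (\<lambda>x. \<Sum>b\<in>Basis. (frechet_derivative f (at x) v \<bullet> b) *\<^sub>R
        frechet_derivative g (at (f x)) b)"
    proof (intro Ck_on_sum Ck_on_bilinear[OF bounded_bilinear_scaleR]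
        Ck_on_bilinear[OF bounded_bilinear_inner] Ck_on_const assms(1))
      fix b :: 'b
      show "Ck_on k S (\<lambda>x. frechet_derivative f (at x) v)" using Suc.prems by auto
      show "Ck_on k S (\<lambda>x. frechet_derivative g (at (f x)) b)"
        by (rule Suc.IH[of "\<lambda>y. frechet_derivative g (at y) b"])
          (use Suc.prems Ck_on_SucD in auto)
    qed
    then show "Ck_on k S (\<lambda>x. frechet_derivative g (at (f x)) (frechet_derivative f (at x) v))"
      by (rule Ck_on_cong[OF assms(1), rotated])
        (metis g has_derivative_linear linear_expand_Basis)
  qed
qed

section \<open>Closure properties of smooth functions\<close>

lemma Cinf_Ck: "Cinf S f \<Longrightarrow> Ck_on k S f"
  by (simp add: Cinf_def)

lemma Cinf_continuous_on: "Cinf S f \<Longrightarrow> continuous_on S f"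
  using Cinf_Ck[of S f 0] by simp

lemma Cinf_subset: "Cinf S f \<Longrightarrow> T \<subseteq> S \<Longrightarrow> Cinf T f"
  by (auto simp: Cinf_def intro: Ck_on_subset)

lemma Cinf_cong: "Cinf S f \<Longrightarrow> open S \<Longrightarrow> (\<And>x. x \<in> S \<Longrightarrow> f x = g x) \<Longrightarrow> Cinf S g"
  unfolding Cinf_def by (metis Ck_on_cong)

lemma Cinf_local: "(\<And>x. x \<in> S \<Longrightarrow> \<exists>W. open W \<and> x \<in> W \<and> Cinf W f) \<Longrightarrow> Cinf S f"
  unfolding Cinf_def by (metis Ck_on_local)

lemma Cinf_has_derivative:
  "Cinf S f \<Longrightarrow> x \<in> S \<Longrightarrow> (f has_derivative frechet_derivative f (at x)) (at x)"
  using Ck_on_has_derivative Cinf_Ck by blast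

lemma Cinf_frechet: "Cinf S f \<Longrightarrow> Cinf S (\<lambda>x. frechet_derivative f (at x) v)"
  by (metis Cinf_def Ck_on.simps(2))

lemma Cinf_const: "open S \<Longrightarrow> Cinf S (\<lambda>x. c)"
  by (simp add: Cinf_def Ck_on_const)

lemma Cinf_linear: "bounded_linear L \<Longrightarrow> open S \<Longrightarrow> Cinf S L"
  by (simp add: Cinf_def Ck_on_linear)

lemma Cinf_id: "open S \<Longrightarrow> Cinf S (\<lambda>x. x)"
  by (simp add: Cinf_linear bounded_linear_ident)

lemma Cinf_add: "Cinf S f \<Longrightarrow> Cinf S g \<Longrightarrow> open S \<Longrightarrow> Cinf S (\<lambda>x. f x + g x)"
  by (simp add: Cinf_def Ck_on_add)

lemma Cinf_sum: "(\<And>i. i \<in> I \<Longrightarrow> Cinf S (f i)) \<Longrightarrow> open S \<Longrightarrow> Cinf S (\<lambda>x. \<Sum>i\<in>I. f i x)"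
  by (simp add: Cinf_def Ck_on_sum)

lemma Cinf_bilinear:
  "bounded_bilinear B \<Longrightarrow> Cinf S f \<Longrightarrow> Cinf S g \<Longrightarrow> open S \<Longrightarrow> Cinf S (\<lambda>x. B (f x) (g x))"
  by (simp add: Cinf_def Ck_on_bilinear)

lemmas Cinf_scaleR = Cinf_bilinear[OF bounded_bilinear_scaleR]
lemmas Cinf_inner = Cinf_bilinear[OF bounded_bilinear_inner]
lemmas Cinf_mult = Cinf_bilinear[OF bounded_bilinear_mult]

lemma Cinf_compose:
  "Cinf T g \<Longrightarrow> Cinf S f \<Longrightarrow> f ` S \<subseteq> T \<Longrightarrow> open S \<Longrightarrow> open T \<Longrightarrow> Cinf S (\<lambda>x. g (f x))"
  unfolding Cinf_def using Ck_on_compose by blast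

lemma Cinf_compose_linear:
  "bounded_linear L \<Longrightarrow> Cinf S f \<Longrightarrow> open S \<Longrightarrow> Cinf S (\<lambda>x. L (f x))"
  by (rule Cinf_compose[OF Cinf_linear[where S=UNIV]]) auto

lemma Cinf_compose_UNIV: "Cinf UNIV g \<Longrightarrow> Cinf S f \<Longrightarrow> open S \<Longrightarrow> Cinf S (\<lambda>x. g (f x))"
  by (rule Cinf_compose) auto

lemma Cinf_minus: "Cinf S f \<Longrightarrow> open S \<Longrightarrow> Cinf S (\<lambda>x. - f x)"
  by (rule Cinf_compose_linear[OF bounded_linear_minus[OF bounded_linear_ident]])

lemma Cinf_diff: "Cinf S f \<Longrightarrow> Cinf S g \<Longrightarrow> open S \<Longrightarrow> Cinf S (\<lambda>x. f x - g x)"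
  using Cinf_add[OF _ Cinf_minus, of S f g] by simp

lemma Cinf_fst: "Cinf S f \<Longrightarrow> open S \<Longrightarrow> Cinf S (\<lambda>x. fst (f x))"
  by (rule Cinf_compose_linear[OF bounded_linear_fst])

lemma Cinf_snd: "Cinf S f \<Longrightarrow> open S \<Longrightarrow> Cinf S (\<lambda>x. snd (f x))"
  by (rule Cinf_compose_linear[OF bounded_linear_snd])

lemma Cinf_Pair:
  assumes "Cinf S f" "Cinf S g" "open S"
  shows "Cinf S (\<lambda>x. (f x, g x))"
proof -
  have "Cinf S (\<lambda>x. (f x, 0) + (0, g x))"
    by (intro Cinf_add Cinf_compose_linear[OF bounded_linear_Pair[OF bounded_linear_ident bounded_linear_zero]]
        Cinf_compose_linear[OF bounded_linear_Pair[OF bounded_linear_zero bounded_linear_ident]] assms)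
  then show ?thesis by simp
qed

text \<open>When a sequence lists successive derivatives, each member is differentiable with
  derivative in the sequence, which is smoothness by induction on the order. This serves for the
  sine and for exp(-1/x).\<close>

lemma Cinf_derivs_real:
  fixes F :: "nat \<Rightarrow> real \<Rightarrow> real"
  assumes "\<And>n x. (F n has_real_derivative F (Suc n) x) (at x)"
  shows "Cinf UNIV (F n)"
proof -
  have "Ck_on k UNIV (F n)" for k
  proof (induction k arbitrary: n)
    case 0
    show ?case using assms by (auto intro!: continuous_at_imp_continuous_on DERIV_isCont)
  next
    case (Suc k)
    show ?case
      by (rule Ck_on_SucI[where D="\<lambda>x v. F (Suc n) x * v"])
        (auto intro!: Ck_on_bilinear[OF bounded_bilinear_mult] Suc Ck_on_const
          assms[unfolded has_field_derivative_def])
  qed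
  then show ?thesis by (simp add: Cinf_def)
qed

lemma Cinf_sin: "Cinf UNIV (sin :: real \<Rightarrow> real)"
proof -
  \<comment> \<open>Differentiating the sine shifts it by pi/2, which puts all derivatives into one
    sequence.\<close>
  have "((\<lambda>x. sin (x + real n * (pi/2))) has_real_derivative sin (x + real (Suc n) * (pi/2))) (at x)"
    for n x
  proof -
    have "x + real (Suc n) * (pi/2) = (x + real n * (pi/2)) + pi/2" by (simp add: algebra_simps)
    then have "sin (x + real (Suc n) * (pi/2)) = cos (x + real n * (pi/2))"
      by (simp only: sin_add) simp
    then show ?thesis by (auto intro!: derivative_eq_intros)
  qed
  then have "Cinf UNIV ((\<lambda>n x. sin (x + real n * (pi/2))) 0)"
    by (rule Cinf_derivs_real)
  then show ?thesis by simp
qed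

lemma Cinf_cos: "Cinf UNIV (cos :: real \<Rightarrow> real)"
proof -
  have "Cinf UNIV (\<lambda>x::real. sin (x + pi/2))"
    by (intro Cinf_compose_UNIV[OF Cinf_sin] Cinf_add Cinf_id Cinf_const) auto
  then show ?thesis by (simp add: sin_add)
qed

lemma Cinf_imp_smooth_on: "Cinf W f \<Longrightarrow> open W \<Longrightarrow> S \<subseteq> W \<Longrightarrow> smooth_on S f"
  unfolding smooth_on_def Cinf_def by blast

lemma smooth_onI:
  assumes "\<And>x. x \<in> S \<Longrightarrow> \<exists>W g. open W \<and> x \<in> W \<and> Cinf W g \<and> (\<forall>y\<in>S \<inter> W. g y = f y)"
  shows "smooth_on S f"
  using assms unfolding smooth_on_def Cinf_def by blast

text \<open>On an open domain the local extensions coincide with \<open>f\<close> itself near each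
  point.\<close>

lemma smooth_on_open:
  assumes "open S"
  shows "smooth_on S f \<longleftrightarrow> Cinf S f"
proof
  assume f: "smooth_on S f"
  show "Cinf S f"
  proof (rule Cinf_local)
    fix x assume "x \<in> S"
    then obtain W g where W: "open W" "x \<in> W" "Cinf W g" "\<forall>y\<in>S \<inter> W. g y = f y"
      using f unfolding smooth_on_def Cinf_def by blast
    have "Cinf (S \<inter> W) f"
      by (rule Cinf_cong[OF Cinf_subset[OF W(3)]]) (use W assms in auto)
    then show "\<exists>W. open W \<and> x \<in> W \<and> Cinf W f"
      using W \<open>x \<in> S\<close> assms by (intro exI[of _ "S \<inter> W"]) auto
  qed
qed (use assms Cinf_imp_smooth_on in blast)

section \<open>Symmetry of second derivatives\<close>

text \<open>Both mixed derivatives are limits of the same second difference quotient.\<close>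

lemma second_difference_mean_value:
  fixes f :: "'a::euclidean_space \<Rightarrow> real"
  assumes "Cinf (ball x r) f" "h > 0" "h * (norm v + norm w) < r"
  obtains s t where "0 < s" "s < h" "0 < t" "t < h"
    "f (x + h *\<^sub>R v + h *\<^sub>R w) - f (x + h *\<^sub>R v) - f (x + h *\<^sub>R w) + f x =
     h * h * frechet_derivative (\<lambda>y. frechet_derivative f (at y) v) (at (x + s *\<^sub>R v + t *\<^sub>R w)) w"
proof -
  define D where "D y = frechet_derivative f (at y) v" for y
  have in_ball: "x + s *\<^sub>R v + t *\<^sub>R w \<in> ball x r" if "0 \<le> s" "s \<le> h" "0 \<le> t" "t \<le> h" for s t
  proof -
    have "norm (s *\<^sub>R v + t *\<^sub>R w) \<le> s * norm v + t * norm w"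
      using that by (metis abs_of_nonneg norm_scaleR norm_triangle_ineq)
    also have "\<dots> \<le> h * norm v + h * norm w"
      using that by (intro add_mono mult_right_mono) auto
    also have "\<dots> < r" using assms(3) by (simp add: algebra_simps)
    finally show ?thesis by (simp add: dist_norm algebra_simps norm_minus_commute)
  qed
  have line: "((\<lambda>s. g (a + s *\<^sub>R u)) has_real_derivative
      frechet_derivative g (at (a + s *\<^sub>R u)) u) (at s)"
    if "Cinf (ball x r) g" "a + s *\<^sub>R u \<in> ball x r" for g :: "'a \<Rightarrow> real" and a u s
  proof -
    have 1: "((\<lambda>s. a + s *\<^sub>R u) has_derivative (\<lambda>k. k *\<^sub>R u)) (at s)"
      by (auto intro!: derivative_eq_intros)
    note d = Cinf_has_derivative[OF that]
    have "((\<lambda>s. g (a + s *\<^sub>R u)) has_derivative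
        (\<lambda>k. frechet_derivative g (at (a + s *\<^sub>R u)) (k *\<^sub>R u))) (at s)"
      using has_derivative_compose[OF 1 d] .
    then show ?thesis
      unfolding has_field_derivative_def
      by (simp add: linear_scale[OF has_derivative_linear[OF d]] mult.commute mult_commute_abs)
  qed
  \<comment> \<open>The mean value theorem along v, for the difference of \<open>f\<close> between
    two parallel segments offset by \<open>h *\<^sub>R w\<close>. A second application, along w,
    treats the directional derivative \<open>D\<close>.\<close>
  have "\<exists>s. 0 < s \<and> s < h \<and>
      (\<lambda>s. f ((x + h *\<^sub>R w) + s *\<^sub>R v) - f (x + s *\<^sub>R v)) h - (\<lambda>s. f ((x + h *\<^sub>R w) + s *\<^sub>R v) - f (x + s *\<^sub>R v)) 0
      = (h - 0) * (D ((x + h *\<^sub>R w) + s *\<^sub>R v) - D (x + s *\<^sub>R v))"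
  proof (rule MVT2[OF assms(2)])
    fix s assume s: "0 \<le> s" "s \<le> h"
    have "x + h *\<^sub>R w + s *\<^sub>R v \<in> ball x r" "x + s *\<^sub>R v \<in> ball x r"
      using in_ball[OF s, of h] in_ball[OF s, of 0] assms(2) by (simp_all add: add_ac)
    then show "((\<lambda>s. f ((x + h *\<^sub>R w) + s *\<^sub>R v) - f (x + s *\<^sub>R v)) has_real_derivative
        D ((x + h *\<^sub>R w) + s *\<^sub>R v) - D (x + s *\<^sub>R v)) (at s)"
      unfolding D_def by (intro DERIV_diff line assms(1))
  qed
  then obtain s where s: "0 < s" "s < h" "f (x + h *\<^sub>R v + h *\<^sub>R w) - f (x + h *\<^sub>R v) - f (x + h *\<^sub>R w) + f x
      = h * (D ((x + s *\<^sub>R v) + h *\<^sub>R w) - D (x + s *\<^sub>R v))"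
    by (auto simp: algebra_simps)
  have "\<exists>t. 0 < t \<and> t < h \<and>
      (\<lambda>t. D ((x + s *\<^sub>R v) + t *\<^sub>R w)) h - (\<lambda>t. D ((x + s *\<^sub>R v) + t *\<^sub>R w)) 0
      = (h - 0) * frechet_derivative D (at ((x + s *\<^sub>R v) + t *\<^sub>R w)) w"
  proof (rule MVT2[OF assms(2)])
    fix t assume "0 \<le> t" "t \<le> h"
    then have "x + s *\<^sub>R v + t *\<^sub>R w \<in> ball x r" using in_ball s by auto
    moreover have "Cinf (ball x r) D" unfolding D_def[abs_def] by (rule Cinf_frechet[OF assms(1)])
    ultimately show "((\<lambda>t. D ((x + s *\<^sub>R v) + t *\<^sub>R w)) has_real_derivative
        frechet_derivative D (at ((x + s *\<^sub>R v) + t *\<^sub>R w)) w) (at t)"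
      by (intro line)
  qed
  then obtain t where t: "0 < t" "t < h" "D ((x + s *\<^sub>R v) + h *\<^sub>R w) - D (x + s *\<^sub>R v)
      = h * frechet_derivative D (at ((x + s *\<^sub>R v) + t *\<^sub>R w)) w"
    by auto
  show ?thesis
    by (rule that[OF s(1,2) t(1,2)]) (use s(3) t(3) in \<open>simp add: D_def[abs_def]\<close>)
qed

lemma mixed_derivatives_real:
  fixes f :: "'a::euclidean_space \<Rightarrow> real"
  assumes "Cinf S f" "open S" "x \<in> S"
  shows "frechet_derivative (\<lambda>y. frechet_derivative f (at y) v) (at x) w =
    frechet_derivative (\<lambda>y. frechet_derivative f (at y) w) (at x) v" (is "?A v w x = ?A w v x")
proof -
  obtain r where r: "r > 0" "ball x r \<subseteq> S" using assms openE by blast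
  have f: "Cinf (ball x r) f" using Cinf_subset[OF assms(1) r(2)] .
  have cont: "isCont (?A v w) x" for v w
  proof -
    have "continuous_on (ball x r) (?A v w)"
      by (intro Cinf_continuous_on Cinf_frechet f)
    then show ?thesis using r(1) by (simp add: continuous_on_eq_continuous_at)
  qed
  \<comment> \<open>The summand 1 keeps the denominator positive when both vectors vanish, and the
    offset 2 makes \<open>r / real (n + 2)\<close> smaller than \<open>r\<close> for every
    n.\<close>
  define h where "h n = r / (norm v + norm w + 1) / real (n + 2)" for n
  have pos: "norm v + norm w + 1 > 0" by (meson add_nonneg_pos norm_ge_zero zero_less_one add_nonneg_nonneg)
  have h0: "h n > 0" for n using r(1) pos by (simp add: h_def)
  have h_lim: "h \<longlonglongrightarrow> 0"
    unfolding h_def by (rule LIMSEQ_ignore_initial_segment[OF lim_const_over_n])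
  have hr: "h n * (norm v + norm w) < r" for n
  proof -
    have "h n * (norm v + norm w) \<le> h n * (norm v + norm w + 1)"
      using h0[of n] by simp
    also have "\<dots> = r / real (n + 2)" using pos by (simp add: h_def)
    also have "\<dots> < r" using r(1) by (simp add: divide_less_eq)
    finally show ?thesis .
  qed
  have ex: "\<exists>X. X \<longlonglongrightarrow> x \<and> (\<forall>n. f (x + h n *\<^sub>R v + h n *\<^sub>R w) - f (x + h n *\<^sub>R v) - f (x + h n *\<^sub>R w) + f x
        = h n * h n * ?A v w (X n))"
    if hr': "\<And>n. h n * (norm v + norm w) < r" for v w
  proof -
    have "\<forall>n. \<exists>p. 0 < fst p \<and> fst p < h n \<and> 0 < snd p \<and> snd p < h n \<and> f (x + h n *\<^sub>R v + h n *\<^sub>R w) - f (x + h n *\<^sub>R v) - f (x + h n *\<^sub>R w) + f x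
        = h n * h n * ?A v w (x + fst p *\<^sub>R v + snd p *\<^sub>R w)" (is "\<forall>n. ?E n")
    proof
      fix n
      obtain s t where "0 < s" "s < h n" "0 < t" "t < h n"
        "f (x + h n *\<^sub>R v + h n *\<^sub>R w) - f (x + h n *\<^sub>R v) - f (x + h n *\<^sub>R w) + f x =
          h n * h n * ?A v w (x + s *\<^sub>R v + t *\<^sub>R w)"
        using second_difference_mean_value[OF f h0 hr'] by blast
      then show "?E n" by (intro exI[of _ "(s, t)"]) simp
    qed
    then obtain p where p: "\<And>n. 0 < fst (p n) \<and> fst (p n) < h n \<and> 0 < snd (p n) \<and> snd (p n) < h n \<and>
        f (x + h n *\<^sub>R v + h n *\<^sub>R w) - f (x + h n *\<^sub>R v) - f (x + h n *\<^sub>R w) + f x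
        = h n * h n * ?A v w (x + fst (p n) *\<^sub>R v + snd (p n) *\<^sub>R w)"
      by metis
    have "(\<lambda>n. fst (p n)) \<longlonglongrightarrow> 0" "(\<lambda>n. snd (p n)) \<longlonglongrightarrow> 0"
      by (rule tendsto_sandwich[OF _ _ tendsto_const h_lim]; use p in \<open>auto intro!: always_eventually less_imp_le\<close>)+
    then have "(\<lambda>n. x + fst (p n) *\<^sub>R v + snd (p n) *\<^sub>R w) \<longlonglongrightarrow> x + 0 *\<^sub>R v + 0 *\<^sub>R w"
      by (intro tendsto_intros)
    then show ?thesis using p by (intro exI[of _ "\<lambda>n. x + fst (p n) *\<^sub>R v + snd (p n) *\<^sub>R w"]) auto
  qed
  obtain X where X: "X \<longlonglongrightarrow> x" "\<And>n. f (x + h n *\<^sub>R v + h n *\<^sub>R w) - f (x + h n *\<^sub>R v) - f (x + h n *\<^sub>R w) + f x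
        = h n * h n * ?A v w (X n)" using ex[OF hr] by blast
  obtain Y where Y: "Y \<longlonglongrightarrow> x" "\<And>n. f (x + h n *\<^sub>R w + h n *\<^sub>R v) - f (x + h n *\<^sub>R w) - f (x + h n *\<^sub>R v) + f x
        = h n * h n * ?A w v (Y n)" using ex[of w v] hr by (auto simp: add.commute)
  \<comment> \<open>The second difference is symmetric in v and w; only the intermediate points
    differ, and both tend to \<open>x\<close>.\<close>
  have "?A v w (X n) = ?A w v (Y n)" for n
  proof -
    have "h n * h n * ?A v w (X n) = h n * h n * ?A w v (Y n)"
      using X(2)[of n] Y(2)[of n]
      unfolding add.assoc add.commute[of "h n *\<^sub>R v" "h n *\<^sub>R w"] by linarith
    then show ?thesis using h0[of n] by simp
  qed
  then show ?thesis
    using isCont_tendsto_compose[OF cont[of v w] X(1)] isCont_tendsto_compose[OF cont[of w v] Y(1)]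
      LIMSEQ_unique by auto
qed

lemma frechet_derivative_inner_left:
  assumes "(f has_derivative f') (at x)"
  shows "frechet_derivative (\<lambda>y. f y \<bullet> b) (at x) v = f' v \<bullet> b"
  using frechet_derivative_at[OF has_derivative_inner_left[OF assms, of b]] by (metis)

text \<open>Taking the inner product with a basis vector commutes with both differentiations, which
  reduces the claim to real functions.\<close>

lemma mixed_derivatives:
  fixes f :: "'a::euclidean_space \<Rightarrow> 'b::euclidean_space"
  assumes "Cinf S f" "open S" "x \<in> S"
  shows "frechet_derivative (\<lambda>y. frechet_derivative f (at y) v) (at x) w =
    frechet_derivative (\<lambda>y. frechet_derivative f (at y) w) (at x) v"
proof (rule euclidean_eqI)
  fix b :: 'b
  have 1: "frechet_derivative (\<lambda>y. frechet_derivative f (at y) v) (at x) w \<bullet> b =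
     frechet_derivative (\<lambda>y. frechet_derivative (\<lambda>y. f y \<bullet> b) (at y) v) (at x) w" for v w
  proof -
    note d = Cinf_has_derivative[OF Cinf_frechet[OF assms(1)] assms(3), of v]
    have "frechet_derivative (\<lambda>y. frechet_derivative f (at y) v \<bullet> b) (at x) =
      frechet_derivative (\<lambda>y. frechet_derivative (\<lambda>y. f y \<bullet> b) (at y) v) (at x)"
      by (rule frechet_derivative_transform_within_open[OF _ assms(2,3)])
        (use d assms(1) in \<open>auto intro!: differentiableI has_derivative_inner_left
            simp: frechet_derivative_inner_left[OF Cinf_has_derivative]\<close>)
    then show ?thesis
      using frechet_derivative_inner_left[OF d] by metis
  qed
  show "frechet_derivative (\<lambda>y. frechet_derivative f (at y) v) (at x) w \<bullet> b =
    frechet_derivative (\<lambda>y. frechet_derivative f (at y) w) (at x) v \<bullet> b"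
    unfolding 1
    by (rule mixed_derivatives_real[OF Cinf_inner[OF assms(1) Cinf_const] assms(2,3)]) (use assms in auto)
qed

section \<open>Charts and tangent vectors\<close>

text \<open>Charts are pairs, and must not be split when they are quantified over.\<close>

declare split_paired_All [simp del] split_paired_Ex [simp del]

lemma cinv_in: "y \<in> snd c ` fst c \<Longrightarrow> cinv c y \<in> fst c"
  by (simp add: cinv_def inv_into_into)

lemma chart_cinv: "y \<in> snd c ` fst c \<Longrightarrow> snd c (cinv c y) = y"
  by (simp add: cinv_def f_inv_into_f)

lemma has_derivative_frechet_transform:
  assumes "(f has_derivative f') (at x)" "open S" "x \<in> S" "\<And>y. y \<in> S \<Longrightarrow> f y = g y"
  shows "frechet_derivative g (at x) = f'"
  using has_derivative_transform_within_open[OF assms] frechet_derivative_at by metis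

text \<open>A common interface for \<open>N\<close> and \<open>cotangent_bundle N\<close>, whose
  topologies arise differently: charts are homeomorphisms onto open sets, with smooth
  transitions.\<close>

locale charted =
  fixes M :: "('a, 'e::euclidean_space) mfd"
  assumes inj_chart: "c \<in> atlas M \<Longrightarrow> inj_on (snd c) (fst c)"
    and openin_chart_vimage: "c \<in> atlas M \<Longrightarrow> open W \<Longrightarrow> openin (mtop M) {z \<in> fst c. snd c z \<in> W}"
    and open_chart_image: "c \<in> atlas M \<Longrightarrow> openin (mtop M) A \<Longrightarrow> open (snd c ` (fst c \<inter> A))"
    and ex_chart: "x \<in> pts M \<Longrightarrow> \<exists>c\<in>atlas M. x \<in> fst c"
    and trans_smooth: "c \<in> atlas M \<Longrightarrow> c' \<in> atlas M \<Longrightarrow>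
      Cinf (snd c ` (fst c \<inter> fst c')) (snd c' \<circ> cinv c)"
begin

lemma openin_dom: "c \<in> atlas M \<Longrightarrow> openin (mtop M) (fst c)"
  using openin_chart_vimage[of c UNIV] by simp

lemma dom_subset: "c \<in> atlas M \<Longrightarrow> fst c \<subseteq> pts M"
  using openin_dom openin_subset by blast

lemma open_image: "c \<in> atlas M \<Longrightarrow> open (snd c ` fst c)"
  using open_chart_image[OF _ openin_dom] by fastforce

lemma open_overlap: "c \<in> atlas M \<Longrightarrow> c' \<in> atlas M \<Longrightarrow> open (snd c ` (fst c \<inter> fst c'))"
  using open_chart_image openin_dom by blast

lemma cinv_chart: "c \<in> atlas M \<Longrightarrow> x \<in> fst c \<Longrightarrow> cinv c (snd c x) = x"
  by (simp add: cinv_def inj_chart)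

lemma charts_atD: "c \<in> charts_at M x \<Longrightarrow> c \<in> atlas M" "c \<in> charts_at M x \<Longrightarrow> x \<in> fst c"
  by (auto simp: charts_at_def)

lemma charts_atI: "c \<in> atlas M \<Longrightarrow> x \<in> fst c \<Longrightarrow> c \<in> charts_at M x"
  by (auto simp: charts_at_def)

lemma chart_at_in: "x \<in> pts M \<Longrightarrow> chart_at M x \<in> charts_at M x"
  unfolding chart_at_def charts_at_def by (rule someI_ex) (use ex_chart in blast)

lemma charts_at_pts: "c \<in> charts_at M x \<Longrightarrow> x \<in> pts M"
  using charts_atD dom_subset by blast

section \<open>Tangent vectors, differentials and velocities in coordinates\<close>

abbreviation DT where
  "DT c c' x \<equiv> frechet_derivative (snd c' \<circ> cinv c) (at (snd c x))"

lemma trans_has_derivative: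
  assumes "c \<in> charts_at M x" "c' \<in> charts_at M x"
  shows "((snd c' \<circ> cinv c) has_derivative DT c c' x) (at (snd c x))"
  by (rule Cinf_has_derivative[OF trans_smooth[of c c']]) (use assms charts_atD in auto)

lemma DT_linear:
  assumes "c \<in> charts_at M x" "c' \<in> charts_at M x"
  shows "linear (DT c c' x)"
  using trans_has_derivative[OF assms] has_derivative_linear by blast

text \<open>The cocycle identity, from the chain rule; by it \<open>coord_vec\<close> satisfies the
  transformation law of tangent vectors.\<close>

lemma DT_compose:
  assumes "c \<in> charts_at M x" "c' \<in> charts_at M x" "c'' \<in> charts_at M x"
  shows "DT c c'' x v = DT c' c'' x (DT c c' x v)"
proof -
  note c = charts_atD[OF assms(1)] and c' = charts_atD[OF assms(2)]
  have x: "(snd c' \<circ> cinv c) (snd c x) = snd c' x" using c by (simp add: cinv_chart)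
  have "((\<lambda>y. (snd c'' \<circ> cinv c') ((snd c' \<circ> cinv c) y)) has_derivative
      (\<lambda>v. DT c' c'' x (DT c c' x v))) (at (snd c x))"
    by (rule has_derivative_compose[OF trans_has_derivative[OF assms(1,2)]])
      (simp only: x trans_has_derivative[OF assms(2,3)])
  then have "DT c c'' x = (\<lambda>v. DT c' c'' x (DT c c' x v))"
    by (rule has_derivative_frechet_transform[OF _ open_overlap[OF c(1) c'(1)]])
      (use c c' in \<open>auto simp: cinv_chart\<close>)
  then show ?thesis by simp
qed

lemma DT_self:
  assumes "c \<in> charts_at M x"
  shows "DT c c x v = v"
proof -
  note c = charts_atD[OF assms]
  have "DT c c x = (\<lambda>v. v)"
    by (rule has_derivative_frechet_transform[OF has_derivative_ident open_image[OF c(1)]])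
      (use c in \<open>auto simp: cinv_chart\<close>)
  then show ?thesis by simp
qed

lemma coord_vec_apply:
  "c' \<in> charts_at M x \<Longrightarrow> coord_vec M c x a c' = DT c c' x a"
  by (simp add: coord_vec_def)

lemma coord_vec_self: "c \<in> charts_at M x \<Longrightarrow> coord_vec M c x a c = a"
  by (simp add: coord_vec_def DT_self)

lemma coord_vec_tangent: "c \<in> charts_at M x \<Longrightarrow> coord_vec M c x a \<in> tangent_space M x"
  unfolding tangent_space_def
  by (auto simp: coord_vec_def intro: DT_compose)

lemma tangent_DT:
  "v \<in> tangent_space M x \<Longrightarrow> c \<in> charts_at M x \<Longrightarrow> c' \<in> charts_at M x \<Longrightarrow> v c' = DT c c' x (v c)"
  unfolding tangent_space_def by blast

text \<open>The transformation law fixes the family on the charts around x, and the default value 0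
  fixes it on all other pairs.\<close>

lemma tangent_eq_coord_vec:
  assumes "v \<in> tangent_space M x" "c \<in> charts_at M x"
  shows "v = coord_vec M c x (v c)"
proof
  fix c'
  show "v c' = coord_vec M c x (v c) c'"
  proof (cases "c' \<in> charts_at M x")
    case True
    show ?thesis unfolding coord_vec_apply[OF True] by (rule tangent_DT[OF assms True])
  next
    case False
    then show ?thesis using assms(1) by (simp add: coord_vec_def tangent_space_def)
  qed
qed

lemma coord_vec_change:
  assumes "c \<in> charts_at M x" "c' \<in> charts_at M x"
  shows "coord_vec M c x a = coord_vec M c' x (DT c c' x a)"
  by (rule tangent_eq_coord_vec[OF coord_vec_tangent[OF assms(1)] assms(2),
        unfolded coord_vec_apply[OF assms(2)]])

lemma coord_vec_0:
  assumes "c \<in> charts_at M x"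
  shows "coord_vec M c x 0 = (\<lambda>_. 0)"
  by (rule ext) (simp add: coord_vec_def linear_0[OF DT_linear[OF assms]])

lemma tangent_spaceI:
  assumes "\<And>c c'. c \<in> charts_at M x \<Longrightarrow> c' \<in> charts_at M x \<Longrightarrow> v c' = DT c c' x (v c)"
    "\<And>c. c \<notin> charts_at M x \<Longrightarrow> v c = 0"
  shows "v \<in> tangent_space M x"
  unfolding tangent_space_def using assms by blast

lemma tangent_outside: "v \<in> tangent_space M x \<Longrightarrow> c \<notin> charts_at M x \<Longrightarrow> v c = 0"
  unfolding tangent_space_def by blast

text \<open>Frees \<open>differential\<close> from the arbitrary choice of \<open>chart_at\<close>:
  the chain rule moves the computation to any chart around x.\<close>

lemma differential_chart:
  assumes "c \<in> charts_at M x" "((h \<circ> cinv c) has_derivative h') (at (snd c x))" "v \<in> tangent_space M x"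
  shows "differential M h x v = h' (v c)"
proof -
  define d where "d = chart_at M x"
  have d: "d \<in> charts_at M x" unfolding d_def by (rule chart_at_in[OF charts_at_pts[OF assms(1)]])
  have x: "(snd c \<circ> cinv d) (snd d x) = snd c x" using charts_atD[OF d] by (simp add: cinv_chart)
  have "((\<lambda>y. (h \<circ> cinv c) ((snd c \<circ> cinv d) y)) has_derivative (\<lambda>v. h' (DT d c x v))) (at (snd d x))"
    by (rule has_derivative_compose[OF trans_has_derivative[OF d assms(1)]])
      (simp only: x assms(2))
  then have "frechet_derivative (h \<circ> cinv d) (at (snd d x)) = (\<lambda>v. h' (DT d c x v))"
    by (rule has_derivative_frechet_transform
        [OF _ open_overlap[OF charts_atD(1)[OF d] charts_atD(1)[OF assms(1)]]])
      (use charts_atD[OF d] charts_atD[OF assms(1)] in \<open>auto simp: cinv_chart\<close>)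
  then show ?thesis
    unfolding differential_def d_def[symmetric] Let_def
    by (simp add: tangent_DT[OF assms(3) d assms(1)])
qed

lemma curve_locally_in:
  assumes "continuous_map (top_of_set I) (mtop M) \<gamma>" "(t::real) \<in> I" "openin (mtop M) A" "\<gamma> t \<in> A"
  obtains d where "d > 0" "\<And>s. s \<in> I \<Longrightarrow> dist s t < d \<Longrightarrow> \<gamma> s \<in> A"
proof -
  have "openin (top_of_set I) {s \<in> I. \<gamma> s \<in> A}"
    using openin_continuous_map_preimage[OF assms(1,3)] by simp
  then obtain d where "d > 0" "\<forall>s\<in>I. dist s t < d \<longrightarrow> s \<in> {s \<in> I. \<gamma> s \<in> A}"
    using assms(2,4) unfolding openin_euclidean_subtopology_iff by blast
  then show ?thesis using that by blast
qed

text \<open>\<open>is_ham_flow\<close> prescribes the velocity in every chart around the moving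
  point; by the chain rule one chart is enough. Continuity keeps the curve in the first chart for
  nearby times.\<close>

lemma velocity_change_chart:
  assumes "continuous_map (top_of_set I) (mtop M) \<gamma>" "(t::real) \<in> I"
    "c \<in> charts_at M (\<gamma> t)" "c' \<in> charts_at M (\<gamma> t)" "v \<in> tangent_space M (\<gamma> t)"
    "((\<lambda>s. snd c (\<gamma> s)) has_vector_derivative v c) (at t within I)"
  shows "((\<lambda>s. snd c' (\<gamma> s)) has_vector_derivative v c') (at t within I)"
proof -
  note c = charts_atD[OF assms(3)]
  obtain d where d: "d > 0" "\<And>s. s \<in> I \<Longrightarrow> dist s t < d \<Longrightarrow> \<gamma> s \<in> fst c"
    using curve_locally_in[OF assms(1,2) openin_dom[OF c(1)] c(2)] by blast
  have 1: "((\<lambda>s. snd c (\<gamma> s)) has_derivative (\<lambda>h. h *\<^sub>R v c)) (at t within I)"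
    using assms(6) by (simp add: has_vector_derivative_def)
  have "((\<lambda>s. (snd c' \<circ> cinv c) (snd c (\<gamma> s))) has_derivative (\<lambda>h. DT c c' (\<gamma> t) (h *\<^sub>R v c))) (at t within I)"
    by (rule has_derivative_compose[OF 1 trans_has_derivative[OF assms(3,4)]])
  then have "((\<lambda>s. (snd c' \<circ> cinv c) (snd c (\<gamma> s))) has_vector_derivative v c') (at t within I)"
    unfolding has_vector_derivative_def
    by (simp add: tangent_DT[OF assms(5,3,4)] linear_scale[OF DT_linear[OF assms(3,4)]])
  then show ?thesis
    by (rule has_vector_derivative_transform_within[OF _ d(1) assms(2)])
      (use d(2) c in \<open>auto simp: cinv_chart\<close>)
qed

subsection \<open>Covectors\<close>

text \<open>The inverse of \<open>momentum c x\<close>, with the value 0 off the tangent space that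
  \<open>cotangent_space\<close> demands.\<close>

definition covec :: "('a, 'e) chart \<Rightarrow> 'a \<Rightarrow> 'e \<Rightarrow> ('a, 'e) tvec \<Rightarrow> real" where
  "covec c x p = (\<lambda>v. if v \<in> tangent_space M x then p \<bullet> v c else 0)"

definition momentum :: "('a, 'e) chart \<Rightarrow> 'a \<Rightarrow> (('a, 'e) tvec \<Rightarrow> real) \<Rightarrow> 'e" where
  "momentum c x \<alpha> = (\<Sum>b\<in>Basis. \<alpha> (coord_vec M c x b) *\<^sub>R b)"

lemma tangent_add:
  assumes "v \<in> tangent_space M x" "w \<in> tangent_space M x"
  shows "(\<lambda>c. v c + w c) \<in> tangent_space M x"
  by (rule tangent_spaceI)
    (simp_all only: linear_add[OF DT_linear] tangent_DT[OF assms(1), symmetric]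
      tangent_DT[OF assms(2), symmetric] tangent_outside[OF assms(1)] tangent_outside[OF assms(2)]
      add_0 not_False_eq_True)

lemma tangent_scale:
  assumes "v \<in> tangent_space M x"
  shows "(\<lambda>c. r *\<^sub>R v c) \<in> tangent_space M x"
  by (rule tangent_spaceI)
    (simp_all only: linear_scale[OF DT_linear] tangent_DT[OF assms, symmetric]
      tangent_outside[OF assms] scaleR_zero_right not_False_eq_True)

lemma covec_in:
  assumes "c \<in> charts_at M x"
  shows "covec c x p \<in> cotangent_space M x"
  unfolding cotangent_space_def covec_def
  by (auto simp: tangent_add tangent_scale inner_add_right)

lemma cotangentD:
  assumes "\<alpha> \<in> cotangent_space M x"
  shows "v \<in> tangent_space M x \<Longrightarrow> w \<in> tangent_space M x \<Longrightarrow> \<alpha> (\<lambda>c. v c + w c) = \<alpha> v + \<alpha> w"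
    "v \<in> tangent_space M x \<Longrightarrow> \<alpha> (\<lambda>c. r *\<^sub>R v c) = r * \<alpha> v"
    "v \<notin> tangent_space M x \<Longrightarrow> \<alpha> v = 0"
  using assms unfolding cotangent_space_def by auto

lemma covector_coord_vec_linear:
  assumes "\<alpha> \<in> cotangent_space M x" "c \<in> charts_at M x"
  shows "linear (\<lambda>a. \<alpha> (coord_vec M c x a))"
proof
  fix a b r
  have "coord_vec M c x (a + b) = (\<lambda>c'. coord_vec M c x a c' + coord_vec M c x b c')"
    using linear_add[OF DT_linear[OF assms(2)]] by (auto simp: coord_vec_def)
  then show "\<alpha> (coord_vec M c x (a + b)) = \<alpha> (coord_vec M c x a) + \<alpha> (coord_vec M c x b)"
    by (simp add: cotangentD(1)[OF assms(1)] coord_vec_tangent[OF assms(2)])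
  have "coord_vec M c x (r *\<^sub>R a) = (\<lambda>c'. r *\<^sub>R coord_vec M c x a c')"
    using linear_scale[OF DT_linear[OF assms(2)]] by (auto simp: coord_vec_def)
  then show "\<alpha> (coord_vec M c x (r *\<^sub>R a)) = r *\<^sub>R \<alpha> (coord_vec M c x a)"
    by (simp add: cotangentD(2)[OF assms(1)] coord_vec_tangent[OF assms(2)])
qed

lemma covector_coord_vec:
  assumes "\<alpha> \<in> cotangent_space M x" "c \<in> charts_at M x"
  shows "\<alpha> (coord_vec M c x a) = momentum c x \<alpha> \<bullet> a"
  using linear_expand_Basis[OF covector_coord_vec_linear[OF assms], of a]
  by (simp add: momentum_def inner_sum_left inner_commute[of a] mult.commute)

lemma momentum_covec:
  assumes "c \<in> charts_at M x"
  shows "momentum c x (covec c x p) = p"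
  unfolding momentum_def covec_def using assms
  by (simp add: coord_vec_tangent coord_vec_self euclidean_representation)

lemma covec_momentum:
  assumes "\<alpha> \<in> cotangent_space M x" "c \<in> charts_at M x"
  shows "covec c x (momentum c x \<alpha>) = \<alpha>"
proof
  fix v
  show "covec c x (momentum c x \<alpha>) v = \<alpha> v"
  proof (cases "v \<in> tangent_space M x")
    case True
    then show ?thesis
      using covector_coord_vec[OF assms, of "v c"]
      by (simp add: covec_def tangent_eq_coord_vec[OF True assms(2), symmetric])
  qed (simp add: covec_def cotangentD(3)[OF assms(1)])
qed

text \<open>Evaluating a covector on a vector does not depend on coordinates. In terms of
  \<open>momentum\<close> this is the invariance of p dq.\<close>

lemma momentum_DT:
  assumes "\<alpha> \<in> cotangent_space M x" "c \<in> charts_at M x" "c' \<in> charts_at M x"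
  shows "momentum c' x \<alpha> \<bullet> DT c c' x a = momentum c x \<alpha> \<bullet> a"
  using covector_coord_vec[OF assms(1,2), of a] covector_coord_vec[OF assms(1,3), of "DT c c' x a"]
    coord_vec_change[OF assms(2,3), of a] by metis

end

text \<open>The homeomorphism condition speaks of subspace topologies; openness of the chart domain
  and of its image turns relatively open sets into open ones.\<close>

lemma charted_smooth_manifold:
  assumes "smooth_manifold N"
  shows "charted N"
proof
  fix c assume c: "c \<in> atlas N"
  have U: "openin (mtop N) (fst c)"
    and op: "open (snd c ` fst c)"
    and hom: "homeomorphic_map (subtopology (mtop N) (fst c)) (top_of_set (snd c ` fst c)) (snd c)"
    using assms c unfolding smooth_manifold_def by auto
  have ts: "topspace (subtopology (mtop N) (fst c)) = fst c"
    using openin_subset[OF U] by auto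
  show "inj_on (snd c) (fst c)"
    using homeomorphic_imp_injective_map[OF hom] ts by simp
  show "openin (mtop N) {z \<in> fst c. snd c z \<in> W}" if "open W" for W
  proof -
    have "openin (top_of_set (snd c ` fst c)) (snd c ` fst c \<inter> W)"
      using that by (simp add: openin_open_Int)
    then have "openin (subtopology (mtop N) (fst c)) {z \<in> fst c. snd c z \<in> snd c ` fst c \<inter> W}"
      using openin_continuous_map_preimage[OF homeomorphic_imp_continuous_map[OF hom]] ts by metis
    moreover have "{z \<in> fst c. snd c z \<in> snd c ` fst c \<inter> W} = {z \<in> fst c. snd c z \<in> W}" by auto
    ultimately show ?thesis using U openin_trans_full by metis
  qed
  show "open (snd c ` (fst c \<inter> A))" if "openin (mtop N) A" for A
  proof -
    have "openin (subtopology (mtop N) (fst c)) (fst c \<inter> A)"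
      using that by (simp add: openin_subtopology_Int2)
    then have "openin (top_of_set (snd c ` fst c)) (snd c ` (fst c \<inter> A))"
      using homeomorphic_imp_open_map[OF hom] unfolding open_map_def by blast
    then show ?thesis using op openin_open_trans by blast
  qed
  note img = this
  show "Cinf (snd c ` (fst c \<inter> fst c')) (snd c' \<circ> cinv c)" if c': "c' \<in> atlas N" for c'
  proof -
    have "openin (mtop N) (fst c')" "smooth_on (snd c ` (fst c \<inter> fst c')) (snd c' \<circ> cinv c)"
      using assms c c' unfolding smooth_manifold_def by auto
    then show ?thesis using smooth_on_open[OF img] by blast
  qed
next
  show "\<exists>c\<in>atlas N. x \<in> fst c" if "x \<in> pts N" for x
    using assms that unfolding smooth_manifold_def by blast
qed

section \<open>The cotangent bundle in coordinates\<close>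

locale cotangent = N: charted N for N :: "('a, 'e::euclidean_space) mfd"
begin

abbreviation TN where "TN \<equiv> cotangent_bundle N"
abbreviation CC where "CC \<equiv> cotangent_chart N"

lemma fst_CC: "fst (CC c) = Sigma (fst c) (cotangent_space N)"
  by (simp add: cotangent_chart_def)

lemma snd_CC: "snd (CC c) z = (snd c (fst z), N.momentum c (fst z) (snd z))"
  by (simp add: cotangent_chart_def N.momentum_def split_beta)

lemma mem_CC: "z \<in> fst (CC c) \<longleftrightarrow> fst z \<in> fst c \<and> snd z \<in> cotangent_space N (fst z)"
  by (cases z) (simp add: fst_CC)

lemma atlas_TN: "atlas TN = CC ` atlas N"
  by (simp add: cotangent_bundle_def)

lemma inj_CC:
  assumes "c \<in> atlas N"
  shows "inj_on (snd (CC c)) (fst (CC c))"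
proof (rule inj_onI)
  fix z z' assume z: "z \<in> fst (CC c)" "z' \<in> fst (CC c)" "snd (CC c) z = snd (CC c) z'"
  have 1: "fst z = fst z'"
    using z N.inj_chart[OF assms] by (auto simp: snd_CC fst_CC dest: inj_onD)
  have "N.momentum c (fst z) (snd z) = N.momentum c (fst z) (snd z')"
    using z(3) unfolding snd_CC 1 by simp
  moreover have "N.covec c (fst z) (N.momentum c (fst z) (snd z)) = snd z"
    "N.covec c (fst z) (N.momentum c (fst z) (snd z')) = snd z'"
    using z 1 assms by (auto intro!: N.covec_momentum N.charts_atI simp: fst_CC)
  ultimately show "z = z'" using 1 by (metis prod_eqI)
qed

lemma CC_covec:
  assumes "c \<in> atlas N" "x \<in> fst c"
  shows "(x, N.covec c x p) \<in> fst (CC c)" "snd (CC c) (x, N.covec c x p) = (snd c x, p)"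
  using assms N.charts_atI[OF assms] by (simp_all add: fst_CC snd_CC N.covec_in N.momentum_covec)

lemma CC_image:
  assumes "c \<in> atlas N" "A \<subseteq> fst c"
  shows "snd (CC c) ` (Sigma A (cotangent_space N)) = snd c ` A \<times> UNIV"
proof
  show "snd (CC c) ` (Sigma A (cotangent_space N)) \<subseteq> snd c ` A \<times> UNIV"
    by (auto simp: snd_CC)
  show "snd c ` A \<times> UNIV \<subseteq> snd (CC c) ` (Sigma A (cotangent_space N))"
  proof
    fix y assume "y \<in> snd c ` A \<times> (UNIV :: 'e set)"
    then obtain x where x: "x \<in> A" "y = (snd c x, snd y)" by (auto simp: prod_eq_iff)
    then have "x \<in> fst c" using assms by auto
    then have "y = snd (CC c) (x, N.covec c x (snd y))" "(x, N.covec c x (snd y)) \<in> fst (CC c)"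
      using x CC_covec[OF assms(1), of x] by auto
    then show "y \<in> snd (CC c) ` (Sigma A (cotangent_space N))"
      using x(1) by (intro image_eqI[of _ _ "(x, N.covec c x (snd y))"]) (auto simp: fst_CC)
  qed
qed

lemma CC_image_dom: "c \<in> atlas N \<Longrightarrow> snd (CC c) ` fst (CC c) = snd c ` fst c \<times> UNIV"
  by (simp add: CC_image fst_CC)

lemma CC_overlap: "fst (CC c) \<inter> fst (CC c') = Sigma (fst c \<inter> fst c') (cotangent_space N)"
  by (auto simp: fst_CC)

lemma CC_image_overlap:
  "c \<in> atlas N \<Longrightarrow> snd (CC c) ` (fst (CC c) \<inter> fst (CC c')) = snd c ` (fst c \<inter> fst c') \<times> UNIV"
  by (simp add: CC_image CC_overlap)

lemma cinv_CC:
  assumes "c \<in> atlas N" "y \<in> snd c ` fst c"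
  shows "cinv (CC c) (y, p) = (cinv c y, N.covec c (cinv c y) p)"
  unfolding cinv_def[of "CC c"]
  by (rule inv_into_f_eq[OF inj_CC[OF assms(1)]])
    (use CC_covec[OF assms(1) cinv_in[OF assms(2)]] chart_cinv[OF assms(2)] in auto)

lemma openin_TN_basis:
  "c \<in> atlas N \<Longrightarrow> open W \<Longrightarrow> openin (mtop TN) {z \<in> fst (CC c). snd (CC c) z \<in> W}"
  unfolding cotangent_bundle_def by (auto intro!: topology_generated_by_Basis)

lemma pts_TN: "z \<in> pts TN \<longleftrightarrow> fst z \<in> pts N \<and> snd z \<in> cotangent_space N (fst z)"
proof -
  have "pts TN = (\<Union>c\<in>atlas N. fst (CC c))"
    unfolding cotangent_bundle_def by (auto intro: exI[of _ UNIV])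
  moreover have "pts N = (\<Union>c\<in>atlas N. fst c)"
    using N.ex_chart N.dom_subset by blast
  ultimately show ?thesis using mem_CC by blast
qed

text \<open>A covector is evaluated on the coordinate vectors of the new chart, so momenta transform
  by the transpose of the derivative of the inverse transition.\<close>

lemma CC_trans:
  assumes "c \<in> atlas N" "c' \<in> atlas N" "y \<in> snd c ` (fst c \<inter> fst c') \<times> UNIV"
  shows "(snd (CC c') \<circ> cinv (CC c)) y = (snd c' (cinv c (fst y)),
    \<Sum>b\<in>Basis. (snd y \<bullet> frechet_derivative (snd c \<circ> cinv c') (at (snd c' (cinv c (fst y)))) b) *\<^sub>R b)"
proof -
  define x where "x = cinv c (fst y)"
  have y: "fst y \<in> snd c ` fst c" using assms(3) by auto
  have x: "x \<in> fst c" "x \<in> fst c'"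
    unfolding x_def using assms(3) by (auto simp: N.cinv_chart[OF assms(1)])
  then have ch: "c \<in> charts_at N x" "c' \<in> charts_at N x" using assms N.charts_atI by auto
  have "cinv (CC c) y = (x, N.covec c x (snd y))"
    using cinv_CC[OF assms(1) y, of "snd y"] by (simp add: x_def)
  moreover have "N.momentum c' x (N.covec c x (snd y)) =
      (\<Sum>b\<in>Basis. (snd y \<bullet> frechet_derivative (snd c \<circ> cinv c') (at (snd c' x)) b) *\<^sub>R b)"
    by (simp add: N.momentum_def N.covec_def N.coord_vec_tangent[OF ch(2)] N.coord_vec_apply[OF ch(1)])
  ultimately show ?thesis by (simp add: snd_CC x_def[symmetric])
qed

lemma CC_trans_smooth:
  assumes "c \<in> atlas N" "c' \<in> atlas N"
  shows "Cinf (snd c ` (fst c \<inter> fst c') \<times> UNIV) (snd (CC c') \<circ> cinv (CC c))"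
proof (rule Cinf_cong)
  let ?O = "snd c ` (fst c \<inter> fst c')" and ?O' = "snd c' ` (fst c' \<inter> fst c)"
  show op: "open (?O \<times> (UNIV :: 'e set))"
    using N.open_overlap[OF assms] by (simp add: open_Times)
  have q: "Cinf (?O \<times> UNIV) (\<lambda>y::'e \<times> 'e. (snd c' \<circ> cinv c) (fst y))"
    by (rule Cinf_compose[OF N.trans_smooth[OF assms] Cinf_fst[OF Cinf_id]])
      (use op N.open_overlap[OF assms] in auto)
  have "Cinf (?O \<times> UNIV) (\<lambda>y::'e \<times> 'e. frechet_derivative (snd c \<circ> cinv c') (at ((snd c' \<circ> cinv c) (fst y))) b)"
    for b
    by (rule Cinf_compose[OF Cinf_frechet[OF N.trans_smooth[OF assms(2,1)], of b] q])
      (use op N.open_overlap[OF assms(2,1)] in \<open>auto simp: N.cinv_chart[OF assms(1)]\<close>)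
  then show "Cinf (?O \<times> UNIV) (\<lambda>y. ((snd c' \<circ> cinv c) (fst y),
      \<Sum>b\<in>Basis. (snd y \<bullet> frechet_derivative (snd c \<circ> cinv c') (at ((snd c' \<circ> cinv c) (fst y))) b) *\<^sub>R b))"
    by (intro Cinf_Pair q Cinf_sum Cinf_scaleR Cinf_inner Cinf_snd Cinf_id Cinf_const op)
qed (subst CC_trans[OF assms]; simp)

text \<open>Continuity of the bundle projection. It will make the region over the complement of a
  closed set open upstairs.\<close>

lemma openin_TN_vimage:
  assumes "openin (mtop N) A"
  shows "openin (mtop TN) {z \<in> pts TN. fst z \<in> A}"
proof -
  have eq: "{z \<in> pts TN. fst z \<in> A} =
      (\<Union>c\<in>atlas N. {z \<in> fst (CC c). snd (CC c) z \<in> snd c ` (fst c \<inter> A) \<times> UNIV})" (is "?L = ?R")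
  proof (intro equalityI subsetI)
    fix z assume z: "z \<in> ?L"
    then obtain c where "c \<in> atlas N" "fst z \<in> fst c" using N.ex_chart pts_TN by blast
    then show "z \<in> ?R" using z by (intro UN_I[of c]) (auto simp: pts_TN mem_CC snd_CC)
  next
    fix z assume "z \<in> ?R"
    then obtain c where c: "c \<in> atlas N" "z \<in> fst (CC c)" "snd c (fst z) \<in> snd c ` (fst c \<inter> A)"
      by (auto simp: snd_CC)
    then have "fst z \<in> A"
      using inj_onD[OF N.inj_chart[OF c(1)]] by (auto simp: mem_CC)
    then show "z \<in> ?L" using c(2) N.dom_subset[OF c(1)] by (auto simp: pts_TN mem_CC)
  qed
  show ?thesis unfolding eq
    by (intro openin_Union) (auto intro!: openin_TN_basis open_Times N.open_chart_image assms)
qed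

text \<open>The topology is only given by generators, so openness of chart images is proved by
  induction on how an open set is generated; injectivity of the chart handles intersections.\<close>

lemma charted_TN: "charted TN"
proof
  fix ch assume "ch \<in> atlas TN"
  then obtain c where c: "c \<in> atlas N" and ch: "ch = CC c" by (auto simp: atlas_TN)
  show "inj_on (snd ch) (fst ch)" unfolding ch by (rule inj_CC[OF c])
  show "openin (mtop TN) {z \<in> fst ch. snd ch z \<in> W}" if "open W" for W
    unfolding ch by (rule openin_TN_basis[OF c that])
  show "Cinf (snd ch ` (fst ch \<inter> fst ch')) (snd ch' \<circ> cinv ch)" if "ch' \<in> atlas TN" for ch'
    using that CC_trans_smooth[OF c] CC_image_overlap[OF c] unfolding ch atlas_TN by auto
  show "open (snd ch ` (fst ch \<inter> A))" if "openin (mtop TN) A" for A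
  proof -
    let ?f = "snd (CC c)"
    have "generate_topology_on {{z \<in> fst c. snd c z \<in> W} |c W. c \<in> CC ` atlas N \<and> open W} A"
      using that unfolding cotangent_bundle_def by (simp add: openin_topology_generated_by)
    then have "open (?f ` (fst (CC c) \<inter> A))"
    proof induction
      case Empty
      show ?case by simp
    next
      case (Int a b)
      have "?f ` (fst (CC c) \<inter> (a \<inter> b)) = ?f ` (fst (CC c) \<inter> a) \<inter> ?f ` (fst (CC c) \<inter> b)"
        using inj_on_image_Int[OF inj_CC[OF c], of "fst (CC c) \<inter> a" "fst (CC c) \<inter> b"]
        by (simp add: Int_ac)
      then show ?case using Int by auto
    next
      case (UN K)
      have "?f ` (fst (CC c) \<inter> \<Union>K) = (\<Union>k\<in>K. ?f ` (fst (CC c) \<inter> k))" by auto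
      then show ?case using UN by auto
    next
      \<comment> \<open>In the chart \<open>CC c\<close>, a generator coming from another chart is
        the preimage of \<open>W\<close> under the transition map, which is continuous on the open
        overlap.\<close>
      case (Basis s)
      then obtain c' W where c': "c' \<in> atlas N" and W: "open W"
        and s: "s = {z \<in> fst (CC c'). snd (CC c') z \<in> W}" by auto
      let ?O = "snd c ` (fst c \<inter> fst c') \<times> (UNIV::'e set)" and ?g = "snd (CC c') \<circ> cinv (CC c)"
      have g: "?g (?f z) = snd (CC c') z" if "z \<in> fst (CC c)" for z
        using inj_CC[OF c] that by (simp add: cinv_def)
      have "?f ` (fst (CC c) \<inter> s) = ?O \<inter> ?g -` W"
        unfolding CC_image_overlap[OF c, symmetric] s using g by (auto simp del: o_apply)
      moreover have "continuous_on ?O ?g" by (rule Cinf_continuous_on[OF CC_trans_smooth[OF c c']])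
      moreover have "open ?O" using N.open_overlap[OF c c'] by (simp add: open_Times)
      ultimately show ?case using continuous_on_open_vimage W by (metis Int_commute)
    qed
    then show ?thesis unfolding ch .
  qed
next
  fix z assume z: "z \<in> pts TN"
  then obtain c where "c \<in> atlas N" "fst z \<in> fst c" using N.ex_chart pts_TN by blast
  then show "\<exists>c\<in>atlas TN. z \<in> fst c"
    using z by (auto simp: atlas_TN pts_TN mem_CC intro!: bexI[of _ c])
qed

sublocale T: charted "cotangent_bundle N"
  by (rule charted_TN)

section \<open>The Liouville form, the symplectic form and Hamilton's equations in
  coordinates\<close>

lemma CC_charts_at: "c \<in> atlas N \<Longrightarrow> z \<in> fst (CC c) \<Longrightarrow> CC c \<in> charts_at TN z"
  by (auto simp: charts_at_def atlas_TN)

lemma CC_charts_atD: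
  assumes "CC c \<in> charts_at TN z" "c \<in> atlas N"
  shows "c \<in> charts_at N (fst z)" "snd z \<in> cotangent_space N (fst z)"
  using assms by (auto simp: charts_at_def mem_CC)

lemma charts_at_CC_E:
  assumes "ch \<in> charts_at TN z"
  obtains c where "c \<in> atlas N" "ch = CC c" "z \<in> fst (CC c)"
  using assms by (auto simp: charts_at_def atlas_TN)

text \<open>The base component of a cotangent transition is the transition of the base and does not
  involve the momentum.\<close>

lemma fst_DT_CC:
  assumes "c \<in> atlas N" "c' \<in> atlas N" "z \<in> fst (CC c)" "z \<in> fst (CC c')"
  shows "fst (T.DT (CC c) (CC c') z a) = N.DT c c' (fst z) (fst a)"
proof -
  let ?O = "snd c ` (fst c \<inter> fst c') \<times> (UNIV::'e set)"
  note ch = CC_charts_at[OF assms(1,3)] CC_charts_at[OF assms(2,4)]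
  have op: "open ?O" using N.open_overlap[OF assms(1,2)] by (simp add: open_Times)
  have z: "snd (CC c) z \<in> ?O" using assms by (auto simp: snd_CC mem_CC)
  have 1: "((\<lambda>y. fst ((snd (CC c') \<circ> cinv (CC c)) y)) has_derivative (\<lambda>a. fst (T.DT (CC c) (CC c') z a)))
      (at (snd (CC c) z))"
    by (rule has_derivative_fst[OF T.trans_has_derivative[OF ch]])
  have "((\<lambda>y. (snd c' \<circ> cinv c) (fst y)) has_derivative (\<lambda>a. N.DT c c' (fst z) (fst a))) (at (snd (CC c) z))"
    by (rule has_derivative_compose[OF has_derivative_fst[OF has_derivative_ident]])
      (simp only: snd_CC fst_conv N.trans_has_derivative[OF CC_charts_atD(1)[OF ch(1) assms(1)]
          CC_charts_atD(1)[OF ch(2) assms(2)]])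
  then have "((\<lambda>y. fst ((snd (CC c') \<circ> cinv (CC c)) y)) has_derivative (\<lambda>a. N.DT c c' (fst z) (fst a)))
      (at (snd (CC c) z))"
    by (rule has_derivative_transform_within_open[OF _ op z])
      (simp add: CC_trans[OF assms(1,2)] del: o_apply, simp)
  then show ?thesis using has_derivative_unique[OF 1] by metis
qed

text \<open>The familiar p dq. It is computed in the chart chosen by \<open>tangent_map\<close> and
  carried to \<open>c\<close> by \<open>momentum_DT\<close>.\<close>

lemma liouville_CC:
  assumes "c \<in> atlas N" "z \<in> fst (CC c)" "v \<in> tangent_space TN z"
  shows "liouville_form N z v = snd (snd (CC c) z) \<bullet> fst (v (CC c))"
proof -
  note ch = CC_charts_at[OF assms(1,2)]
  obtain d where d: "d \<in> atlas N" "chart_at TN z = CC d" "z \<in> fst (CC d)"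
    using charts_at_CC_E[OF T.chart_at_in[OF T.charts_at_pts[OF ch]]] .
  note dh = CC_charts_at[OF d(1,3)]
  note cN = CC_charts_atD[OF ch assms(1)] and dN = CC_charts_atD[OF dh d(1)]
  have "tangent_map TN N fst z v = coord_vec N d (fst z) (fst (v (CC d)))"
  proof
    fix c'
    show "tangent_map TN N fst z v c' = coord_vec N d (fst z) (fst (v (CC d))) c'"
    proof (cases "c' \<in> charts_at N (fst z)")
      case True
      have "((\<lambda>y. (snd c' \<circ> cinv d) (fst y)) has_derivative (\<lambda>a. N.DT d c' (fst z) (fst a))) (at (snd (CC d) z))"
        by (rule has_derivative_compose[OF has_derivative_fst[OF has_derivative_ident]])
          (simp only: snd_CC fst_conv N.trans_has_derivative[OF dN(1) True])
      then have "frechet_derivative (snd c' \<circ> fst \<circ> cinv (CC d)) (at (snd (CC d) z)) =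
          (\<lambda>a. N.DT d c' (fst z) (fst a))"
        by (rule has_derivative_frechet_transform[of _ _ _ "snd d ` fst d \<times> UNIV"])
          (use d N.open_image[OF d(1)] in \<open>auto simp: cinv_CC open_Times snd_CC fst_CC\<close>)
      then show ?thesis
        using True by (simp add: tangent_map_def d(2) coord_vec_def Let_def)
    qed (simp add: tangent_map_def coord_vec_def Let_def)
  qed
  then have "liouville_form N z v = N.momentum d (fst z) (snd z) \<bullet> fst (v (CC d))"
    unfolding liouville_form_def by (simp add: N.covector_coord_vec[OF dN(2,1)])
  also have "\<dots> = N.momentum c (fst z) (snd z) \<bullet> N.DT d c (fst z) (fst (v (CC d)))"
    by (rule N.momentum_DT[symmetric, OF dN(2,1) cN(1)])
  also have "N.DT d c (fst z) (fst (v (CC d))) = fst (v (CC c))"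
    using fst_DT_CC[OF d(1) assms(1) d(3) assms(2)] T.tangent_DT[OF assms(3) dh ch] by metis
  finally show ?thesis by (simp add: snd_CC)
qed

text \<open>Differentiate the invariance of the Liouville form; the second derivatives cancel by symmetry.\<close>

lemma DT_CC_symplectic:
  assumes "c \<in> atlas N" "c' \<in> atlas N" "z \<in> fst (CC c)" "z \<in> fst (CC c')"
  defines "D \<equiv> T.DT (CC c) (CC c') z"
  shows "fst (D a) \<bullet> snd (D b) - snd (D a) \<bullet> fst (D b) = fst a \<bullet> snd b - snd a \<bullet> fst b"
proof -
  let ?O = "snd c ` (fst c \<inter> fst c') \<times> (UNIV::'e set)"
  define \<tau> where "\<tau> = snd (CC c') \<circ> cinv (CC c)"
  have op: "open ?O" using N.open_overlap[OF assms(1,2)] by (simp add: open_Times)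
  have y0: "snd (CC c) z \<in> ?O" using assms by (auto simp: snd_CC mem_CC)
  have sm: "Cinf ?O \<tau>" unfolding \<tau>_def by (rule CC_trans_smooth[OF assms(1,2)])
  \<comment> \<open>Invariance of p dq, phrased for the map \<open>\<tau>\<close> between Euclidean
    spaces so that it can be differentiated in y.\<close>
  have inv: "snd (\<tau> y) \<bullet> fst (frechet_derivative \<tau> (at y) a) = snd y \<bullet> fst a" if y: "y \<in> ?O" for y a
  proof -
    obtain x where x: "x \<in> fst (CC c)" "x \<in> fst (CC c')" "y = snd (CC c) x"
      using y unfolding CC_image_overlap[OF assms(1), symmetric] by auto
    note ch = CC_charts_at[OF assms(1) x(1)] CC_charts_at[OF assms(2) x(2)]
    have "cinv (CC c) y = x" using T.cinv_chart[of "CC c"] x assms(1) by (simp add: atlas_TN)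
    then have "snd (\<tau> y) = N.momentum c' (fst x) (snd x)"
      by (simp add: \<tau>_def snd_CC)
    moreover have "fst (frechet_derivative \<tau> (at y) a) = N.DT c c' (fst x) (fst a)"
      using fst_DT_CC[OF assms(1,2) x(1,2)] by (simp add: \<tau>_def x(3))
    ultimately show ?thesis
      using N.momentum_DT CC_charts_atD[OF ch(1) assms(1)] CC_charts_atD(1)[OF ch(2) assms(2)]
      by (simp add: x(3) snd_CC)
  qed
  let ?y = "snd (CC c) z"
  note d\<tau> = Cinf_has_derivative[OF sm y0]
  let ?DD = "\<lambda>a b. frechet_derivative (\<lambda>y. frechet_derivative \<tau> (at y) a) (at ?y) b"
  have "snd (\<tau> ?y) \<bullet> fst (?DD a b) + snd (D b) \<bullet> fst (D a) = snd b \<bullet> fst a" for a b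
  proof -
    have 1: "((\<lambda>y. snd (\<tau> y) \<bullet> fst (frechet_derivative \<tau> (at y) a)) has_derivative
        (\<lambda>b. snd (\<tau> ?y) \<bullet> fst (?DD a b) + snd (D b) \<bullet> fst (D a))) (at ?y)"
      unfolding D_def
      using has_derivative_inner[OF has_derivative_snd[OF d\<tau>]
          has_derivative_fst[OF Cinf_has_derivative[OF Cinf_frechet[OF sm] y0]], of a]
      by (simp add: \<tau>_def)
    have 2: "((\<lambda>y. snd y \<bullet> fst a) has_derivative (\<lambda>b. snd b \<bullet> fst a)) (at ?y)"
      by (auto intro!: derivative_eq_intros)
    have "((\<lambda>y. snd (\<tau> y) \<bullet> fst (frechet_derivative \<tau> (at y) a)) has_derivative
        (\<lambda>b. snd b \<bullet> fst a)) (at ?y)"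
      by (rule has_derivative_transform_within_open[OF 2 op y0]) (simp add: inv)
    from fun_cong[OF has_derivative_unique[OF 1 this], of b] show ?thesis .
  qed
  from this[of a b] this[of b a] show ?thesis
    using mixed_derivatives[OF sm op y0, of a b] by (simp add: inner_commute)
qed

text \<open>In the chart used by \<open>exterior_derivative\<close>, the Liouville form of a
  constant field is linear in the momentum, so its derivative is immediate.
  \<open>DT_CC_symplectic\<close> then carries the result to any other cotangent chart.\<close>

lemma canonical_symplectic_form_CC:
  assumes "c \<in> atlas N" "z \<in> fst (CC c)" "v \<in> tangent_space TN z" "w \<in> tangent_space TN z"
  shows "canonical_symplectic_form N z v w =
    fst (v (CC c)) \<bullet> snd (w (CC c)) - snd (v (CC c)) \<bullet> fst (w (CC c))"
proof -
  note ch = CC_charts_at[OF assms(1,2)]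
  obtain d where d: "d \<in> atlas N" "chart_at TN z = CC d" "z \<in> fst (CC d)"
    using charts_at_CC_E[OF T.chart_at_in[OF T.charts_at_pts[OF ch]]] .
  note dh = CC_charts_at[OF d(1,3)]
  let ?O = "snd d ` fst d \<times> (UNIV :: 'e set)"
  have op: "open ?O" using N.open_image[OF d(1)] by (simp add: open_Times)
  have z: "snd (CC d) z \<in> ?O" using d(3) CC_image_dom[OF d(1)] by blast
  have "frechet_derivative (\<lambda>y. liouville_form N (cinv (CC d) y)
      (coord_vec TN (CC d) (cinv (CC d) y) a)) (at (snd (CC d) z)) = (\<lambda>b. snd b \<bullet> fst a)" for a
  proof (rule has_derivative_frechet_transform[OF _ op z])
    show "((\<lambda>y. snd y \<bullet> fst a) has_derivative (\<lambda>b. snd b \<bullet> fst a)) (at (snd (CC d) z))"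
      by (auto intro!: derivative_eq_intros)
    fix y assume "y \<in> ?O"
    then have "y \<in> snd (CC d) ` fst (CC d)" using CC_image_dom[OF d(1)] by simp
    note y = cinv_in[OF this] chart_cinv[OF this]
    show "snd y \<bullet> fst a = liouville_form N (cinv (CC d) y) (coord_vec TN (CC d) (cinv (CC d) y) a)"
      using liouville_CC[OF d(1) y(1) T.coord_vec_tangent] CC_charts_at[OF d(1) y(1)]
      by (simp add: y(2) T.coord_vec_self)
  qed
  then have "canonical_symplectic_form N z v w =
      fst (v (CC d)) \<bullet> snd (w (CC d)) - snd (v (CC d)) \<bullet> fst (w (CC d))"
    by (simp add: canonical_symplectic_form_def exterior_derivative_def d(2) inner_commute Let_def)
  also have "\<dots> = fst (v (CC c)) \<bullet> snd (w (CC c)) - snd (v (CC c)) \<bullet> fst (w (CC c))"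
    unfolding T.tangent_DT[OF assms(3) dh ch] T.tangent_DT[OF assms(4) dh ch]
    by (rule DT_CC_symplectic[OF d(1) assms(1) d(3) assms(2), symmetric])
  finally show ?thesis .
qed

text \<open>Hamilton's equations q' = dh/dp, p' = - dh/dq. Uniqueness, required by the definite
  description, is nondegeneracy: test against the vectors (0, p) and (q, 0).\<close>

lemma ham_vf_CC:
  assumes "c \<in> atlas N" "z \<in> fst (CC c)"
    "((h \<circ> cinv (CC c)) has_derivative (\<lambda>w. g \<bullet> w)) (at (snd (CC c) z))"
  shows "ham_vf TN (canonical_symplectic_form N) h z = coord_vec TN (CC c) z (snd g, - fst g)"
  unfolding ham_vf_def
proof (rule the_equality)
  note ch = CC_charts_at[OF assms(1,2)]
  note dh = T.differential_chart[OF ch assms(3)]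
  note om = canonical_symplectic_form_CC[OF assms(1,2)]
  let ?v = "coord_vec TN (CC c) z (snd g, - fst g)"
  note tv = T.coord_vec_tangent[OF ch]
  show "?v \<in> tangent_space TN z \<and> (\<forall>w\<in>tangent_space TN z. differential TN h z w =
      canonical_symplectic_form N z ?v w)"
    using tv by (auto simp: dh om T.coord_vec_self[OF ch] inner_prod_def)
  fix v assume v: "v \<in> tangent_space TN z \<and> (\<forall>w\<in>tangent_space TN z. differential TN h z w =
      canonical_symplectic_form N z v w)"
  have eq: "g \<bullet> a = fst (v (CC c)) \<bullet> snd a - snd (v (CC c)) \<bullet> fst a" for a
    using v tv[of a] dh[of "coord_vec TN (CC c) z a"] om[of v "coord_vec TN (CC c) z a"]
    by (simp add: T.coord_vec_self[OF ch])
  have "\<forall>p. fst (v (CC c)) \<bullet> p = snd g \<bullet> p"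
  proof
    fix p show "fst (v (CC c)) \<bullet> p = snd g \<bullet> p" using eq[of "(0, p)"] by (simp add: inner_prod_def)
  qed
  moreover have "\<forall>q. snd (v (CC c)) \<bullet> q = (- fst g) \<bullet> q"
  proof
    fix q show "snd (v (CC c)) \<bullet> q = (- fst g) \<bullet> q" using eq[of "(q, 0)"] by (simp add: inner_prod_def)
  qed
  ultimately have "v (CC c) = (snd g, - fst g)"
    unfolding vector_eq_rdot by (simp add: prod_eq_iff)
  then show "v = ?v" using T.tangent_eq_coord_vec[of v z, OF _ ch] v by metis
qed

end

section \<open>Hamiltonian flows supported in a chart\<close>

lemma smooth_on_cong: "smooth_on S f \<Longrightarrow> (\<And>y. y \<in> S \<Longrightarrow> f y = g y) \<Longrightarrow> smooth_on S g"
  unfolding smooth_on_def by (metis IntD1)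

text \<open>Needed for inverses: \<open>inv_into\<close> agrees with the intended inverse on the
  points of M only.\<close>

lemma (in charted) smooth_map_cong:
  assumes "smooth_map M M F" "\<And>x. x \<in> pts M \<Longrightarrow> F x = F' x"
  shows "smooth_map M M F'"
  unfolding smooth_map_def
proof (intro conjI ballI)
  show "continuous_map (mtop M) (mtop M) F'"
    using assms continuous_map_eq unfolding smooth_map_def by blast
  fix c c' assume c: "c \<in> atlas M" "c' \<in> atlas M"
  have eq: "F x = F' x" if "x \<in> fst c" for x using that dom_subset[OF c(1)] assms(2) by blast
  have "fst c \<inter> F' -` fst c' = fst c \<inter> F -` fst c'" using eq by auto
  moreover have "smooth_on (snd c ` (fst c \<inter> F -` fst c')) (snd c' \<circ> F \<circ> cinv c)"
    using assms(1) c unfolding smooth_map_def by blast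
  moreover have "(snd c' \<circ> F \<circ> cinv c) y = (snd c' \<circ> F' \<circ> cinv c) y"
    if "y \<in> snd c ` (fst c \<inter> F -` fst c')" for y
    using that eq cinv_in[of y c] by auto
  ultimately show "smooth_on (snd c ` (fst c \<inter> F' -` fst c')) (snd c' \<circ> F' \<circ> cinv c)"
    using smooth_on_cong by metis
qed

text \<open>Closedness of the image of \<open>B\<close> in N makes \<open>Dom\<close> and
  \<open>Out\<close> an open cover of the cotangent bundle. Objects that are trivial off
  \<open>B\<close> can then be glued from a coordinate expression on \<open>Dom\<close> and the
  identity or zero on \<open>Out\<close>.\<close>

locale supported_in_chart = cotangent N for N :: "('a, 'e::euclidean_space) mfd" +
  fixes c :: "('a, 'e) chart" and B :: "'e set"
  assumes c: "c \<in> atlas N" and B_sub: "B \<subseteq> snd c ` fst c"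
    and B_closed: "openin (mtop N) (pts N - cinv c ` B)"
begin

abbreviation Dom where "Dom \<equiv> fst (CC c)"
abbreviation Out where "Out \<equiv> {z \<in> pts TN. fst z \<in> pts N - cinv c ` B}"

lemma CC_atlas: "CC c \<in> atlas TN"
  using c by (simp add: atlas_TN)

lemma Dom_Out: "z \<in> pts TN \<Longrightarrow> z \<in> Dom \<or> z \<in> Out"
  using B_sub N.cinv_chart[OF c] by (auto simp: pts_TN mem_CC)

lemma Dom_pts: "z \<in> Dom \<Longrightarrow> z \<in> pts TN"
  using T.dom_subset[OF CC_atlas] by blast

lemma openin_Out: "openin (mtop TN) Out"
  by (rule openin_TN_vimage[OF B_closed])

lemma Out_fst: "z \<in> Dom \<Longrightarrow> z \<in> Out \<Longrightarrow> fst (snd (CC c) z) \<notin> B"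
  using N.cinv_chart[OF c, of "fst z"] by (auto simp: snd_CC mem_CC image_iff)

definition lift :: "('e \<times> 'e \<Rightarrow> 'e \<times> 'e) \<Rightarrow> ('a, 'e) cotan \<Rightarrow> ('a, 'e) cotan" where
  "lift F z = (if z \<in> Dom then cinv (CC c) (F (snd (CC c) z)) else z)"

definition lift_fun :: "('e \<times> 'e \<Rightarrow> real) \<Rightarrow> ('a, 'e) cotan \<Rightarrow> real" where
  "lift_fun h z = (if z \<in> Dom then h (snd (CC c) z) else 0)"

text \<open>Only the base coordinate is restricted, the momentum is free. The first clause makes
  gluing with the identity consistent; the second keeps the image inside the chart.\<close>

definition fiberwise_supported :: "('e \<times> 'e \<Rightarrow> 'e \<times> 'e) \<Rightarrow> bool" where
  "fiberwise_supported F \<longleftrightarrow> (\<forall>y. fst y \<notin> B \<longrightarrow> F y = y) \<and> (\<forall>y. fst y \<in> B \<longrightarrow> fst (F y) \<in> B)"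

lemma fiberwise_supported_image:
  assumes "fiberwise_supported F" "z \<in> Dom"
  shows "F (snd (CC c) z) \<in> snd (CC c) ` Dom"
proof -
  have "F y \<in> snd c ` fst c \<times> UNIV" if "y \<in> snd c ` fst c \<times> UNIV" for y
    using assms(1) B_sub that unfolding fiberwise_supported_def
    by (cases "fst y \<in> B") (auto simp: mem_Times_iff)
  then show ?thesis using assms(2) CC_image_dom[OF c] by blast
qed

lemma lift_Dom:
  assumes "fiberwise_supported F" "z \<in> Dom"
  shows "lift F z \<in> Dom" "snd (CC c) (lift F z) = F (snd (CC c) z)"
  using fiberwise_supported_image[OF assms] assms(2) by (simp_all add: lift_def cinv_in chart_cinv)

lemma lift_Out:
  assumes "fiberwise_supported F" "z \<in> Out"
  shows "lift F z = z"
  using assms Out_fst[OF _ assms(2)] T.cinv_chart[OF CC_atlas]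
  by (auto simp: lift_def fiberwise_supported_def)

lemma lift_lift:
  assumes "fiberwise_supported F" "fiberwise_supported F'"
  shows "lift F (lift F' z) = lift (\<lambda>y. F (F' y)) z"
proof (cases "z \<in> Dom")
  case True
  then show ?thesis using lift_Dom[OF assms(2) True] by (simp add: lift_def)
qed (simp add: lift_def)

lemma lift_ident: "lift (\<lambda>y. y) z = z"
  by (simp add: lift_def T.cinv_chart[OF CC_atlas])

lemma lift_pts: "fiberwise_supported F \<Longrightarrow> z \<in> pts TN \<Longrightarrow> lift F z \<in> pts TN"
  using lift_Dom(1)[of F z] Dom_pts by (cases "z \<in> Dom") (auto simp: lift_def)

text \<open>The open cover splits the preimage: on \<open>Dom\<close> it is a preimage under
  \<open>F\<close> in coordinates, on \<open>Out\<close> it is \<open>A\<close> itself.\<close>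

lemma openin_lift_vimage:
  assumes "fiberwise_supported F" "Cinf UNIV F" "openin (mtop TN) A"
  shows "openin (mtop TN) {z \<in> pts TN. lift F z \<in> A}"
proof -
  let ?W = "snd (CC c) ` (Dom \<inter> A)"
  have mem: "lift F z \<in> A \<longleftrightarrow> F (snd (CC c) z) \<in> ?W" if zD: "z \<in> Dom" for z
  proof
    assume "lift F z \<in> A"
    then show "F (snd (CC c) z) \<in> ?W"
      using lift_Dom[OF assms(1) zD] by (metis IntI imageI)
  next
    assume "F (snd (CC c) z) \<in> ?W"
    then obtain z' where z': "z' \<in> Dom" "z' \<in> A" "snd (CC c) (lift F z) = snd (CC c) z'"
      using lift_Dom(2)[OF assms(1) zD] by auto
    then show "lift F z \<in> A"
      using inj_onD[OF T.inj_chart[OF CC_atlas] z'(3)] lift_Dom(1)[OF assms(1) zD] by metis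
  qed
  have "{z \<in> pts TN. lift F z \<in> A} = {z \<in> Dom. snd (CC c) z \<in> F -` ?W} \<union> (Out \<inter> A)" (is "?L = ?R")
  proof (intro equalityI subsetI)
    fix z assume "z \<in> ?L"
    then show "z \<in> ?R" using Dom_Out[of z] mem[of z] lift_Out[OF assms(1), of z] by auto
  next
    fix z assume "z \<in> ?R"
    then show "z \<in> ?L" using Dom_pts[of z] mem[of z] lift_Out[OF assms(1), of z] by auto
  qed
  moreover have "open (F -` ?W)"
    using T.open_chart_image[OF CC_atlas assms(3)] Cinf_continuous_on[OF assms(2)]
    by (simp add: open_vimage)
  ultimately show ?thesis
    using openin_Un[OF T.openin_chart_vimage[OF CC_atlas] openin_Int[OF openin_Out assms(3)]]
    by (simp only:)
qed

text \<open>The same cover decides smoothness. Near a point of \<open>Dom\<close> the map is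
  transition, \<open>F\<close>, transition; near any other point it is the identity, hence a bare
  transition map.\<close>

lemma smooth_map_lift:
  assumes "fiberwise_supported F" "Cinf UNIV F"
  shows "smooth_map TN TN (lift F)"
  unfolding smooth_map_def
proof (intro conjI ballI)
  show "continuous_map (mtop TN) (mtop TN) (lift F)"
    unfolding continuous_map_def using lift_pts[OF assms(1)] openin_lift_vimage[OF assms] by auto
  fix d d' assume d: "d \<in> atlas TN" "d' \<in> atlas TN"
  let ?A = "{z \<in> pts TN. lift F z \<in> fst d'}"
  have A: "openin (mtop TN) ?A" by (rule openin_lift_vimage[OF assms T.openin_dom[OF d(2)]])
  show "smooth_on (snd d ` (fst d \<inter> lift F -` fst d')) (snd d' \<circ> lift F \<circ> cinv d)"
  proof (rule smooth_onI)
    fix y assume "y \<in> snd d ` (fst d \<inter> lift F -` fst d')"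
    then obtain z where z: "z \<in> fst d" "lift F z \<in> fst d'" "y = snd d z" by auto
    then have zp: "z \<in> pts TN" using T.dom_subset[OF d(1)] by blast
    show "\<exists>W g. open W \<and> y \<in> W \<and> Cinf W g \<and>
        (\<forall>y\<in>snd d ` (fst d \<inter> lift F -` fst d') \<inter> W. g y = (snd d' \<circ> lift F \<circ> cinv d) y)"
    proof (cases "z \<in> Dom")
      case True
      let ?W = "snd d ` (fst d \<inter> (Dom \<inter> ?A))"
      have W: "open ?W" using T.open_chart_image[OF d(1)] T.openin_dom[OF CC_atlas] A by blast
      have W_in: "cinv d y \<in> fst d" "cinv d y \<in> Dom" "lift F (cinv d y) \<in> fst d'" if "y \<in> ?W" for y
        using that T.cinv_chart[OF d(1)] by auto
      let ?g = "\<lambda>y. (snd d' \<circ> cinv (CC c)) (F ((snd (CC c) \<circ> cinv d) y))"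
      have "Cinf ?W (snd (CC c) \<circ> cinv d)"
        by (rule Cinf_subset[OF T.trans_smooth[OF d(1) CC_atlas]]) auto
      then have "Cinf ?W (\<lambda>y. F ((snd (CC c) \<circ> cinv d) y))"
        by (rule Cinf_compose_UNIV[OF assms(2) _ W])
      moreover have "(\<lambda>y. F ((snd (CC c) \<circ> cinv d) y)) ` ?W \<subseteq> snd (CC c) ` (Dom \<inter> fst d')"
      proof (rule image_subsetI)
        fix y assume "y \<in> ?W"
        note y = W_in[OF this]
        show "F ((snd (CC c) \<circ> cinv d) y) \<in> snd (CC c) ` (Dom \<inter> fst d')"
          using lift_Dom[OF assms(1) y(2)] y(3) by (metis IntI comp_apply imageI)
      qed
      ultimately have "Cinf ?W ?g"
        by (rule Cinf_compose[OF T.trans_smooth[OF CC_atlas d(2)] _ _ W T.open_overlap[OF CC_atlas d(2)]])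
      moreover have "?g y = (snd d' \<circ> lift F \<circ> cinv d) y" if "y \<in> ?W" for y
        using W_in(2)[OF that] by (simp add: lift_def)
      moreover have "y \<in> ?W" using z zp True by auto
      ultimately show ?thesis using W by blast
    next
      case False
      then have zO: "z \<in> Out" using Dom_Out zp by blast
      let ?W = "snd d ` (fst d \<inter> (Out \<inter> fst d'))"
      have W: "open ?W" using T.open_chart_image[OF d(1)] T.openin_dom[OF d(2)] openin_Out by blast
      moreover have "Cinf ?W (snd d' \<circ> cinv d)"
        by (rule Cinf_subset[OF T.trans_smooth[OF d]]) auto
      moreover have "(snd d' \<circ> cinv d) y = (snd d' \<circ> lift F \<circ> cinv d) y" if "y \<in> ?W" for y
      proof -
        have "cinv d y \<in> Out" using that T.cinv_chart[OF d(1)] by auto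
        then show ?thesis using lift_Out[OF assms(1)] by simp
      qed
      moreover have "y \<in> ?W" using z zO lift_Out[OF assms(1) zO] by auto
      ultimately show ?thesis by blast
    qed
  qed
qed

lemma diffeo_lift:
  assumes "fiberwise_supported F" "Cinf UNIV F" "fiberwise_supported F'" "Cinf UNIV F'"
    "\<And>y. F (F' y) = y" "\<And>y. F' (F y) = y"
  shows "diffeo TN (lift F)"
proof -
  have inv: "lift F (lift F' z) = z" "lift F' (lift F z) = z" for z
    using assms by (simp_all add: lift_lift lift_ident)
  have bij: "bij_betw (lift F) (pts TN) (pts TN)"
    by (rule bij_betw_byWitness[where f'="lift F'"]) (use inv lift_pts assms in auto)
  moreover have "smooth_map TN TN (inv_into (pts TN) (lift F))"
  proof (rule T.smooth_map_cong[OF smooth_map_lift[OF assms(3,4)]])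
    fix z assume "z \<in> pts TN"
    then show "lift F' z = inv_into (pts TN) (lift F) z"
      using inv lift_pts[OF assms(3)] bij by (metis bij_betw_def inv_into_f_eq)
  qed
  ultimately show ?thesis
    unfolding diffeo_def using smooth_map_lift[OF assms(1,2)] Dom_pts by (auto simp: lift_def)
qed

end

text \<open>\<open>G\<close> is the gradient of \<open>h\<close> and \<open>\<Psi>\<close> its
  Hamiltonian flow, given as a one-parameter group on all of \<open>'e \<times> 'e\<close>. Because
  of the group law the velocity is only prescribed at time 0.\<close>

locale chart_flow = supported_in_chart N c B
  for N :: "('a, 'e::euclidean_space) mfd" and c B +
  fixes h :: "'e \<times> 'e \<Rightarrow> real" and G :: "'e \<times> 'e \<Rightarrow> 'e \<times> 'e" and \<Psi> :: "real \<Rightarrow> 'e \<times> 'e \<Rightarrow> 'e \<times> 'e"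
  assumes h_smooth: "Cinf UNIV h"
    and h_derivative: "(h has_derivative (\<lambda>w. G y \<bullet> w)) (at y)"
    and h_Out: "fst y \<notin> B \<Longrightarrow> h y = 0"
    and flow_smooth: "Cinf UNIV (\<lambda>p. \<Psi> (fst p) (snd p))"
    and flow_0: "\<Psi> 0 y = y"
    and flow_add: "\<Psi> (s + t) y = \<Psi> s (\<Psi> t y)"
    and flow_Out: "fst y \<notin> B \<Longrightarrow> \<Psi> t y = y"
    and flow_generator: "((\<lambda>t. \<Psi> t y) has_vector_derivative (snd (G y), - fst (G y))) (at 0)"
begin

definition X where "X y = (snd (G y), - fst (G y))"

abbreviation H where "H \<equiv> lift_fun h"

lemma flow_inverse: "\<Psi> t (\<Psi> (- t) y) = y" "\<Psi> (- t) (\<Psi> t y) = y"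
  using flow_add[of t "- t" y] flow_add[of "- t" t y] by (simp_all add: flow_0)

text \<open>A point over \<open>B\<close> cannot be carried off \<open>B\<close>: its image would be
  fixed by \<open>\<Psi> (- t)\<close>, hence equal to the point itself.\<close>

lemma flow_supported: "fiberwise_supported (\<Psi> t)"
  unfolding fiberwise_supported_def using flow_Out flow_inverse(2) by metis

lemma flow_smooth_space: "Cinf UNIV (\<Psi> t)"
  using Cinf_compose_UNIV[OF flow_smooth Cinf_Pair[OF Cinf_const Cinf_id], of UNIV t] by simp

text \<open>The group law moves the generator from time 0 to time t.\<close>

lemma flow_velocity: "((\<lambda>t. \<Psi> t y) has_vector_derivative X (\<Psi> t y)) (at t)"
proof -
  have g: "((\<lambda>s. \<Psi> s (\<Psi> t y)) has_vector_derivative X (\<Psi> t y)) (at (t - t))"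
    using flow_generator[of "\<Psi> t y"] by (simp add: X_def)
  have "((\<lambda>s. s - t) has_vector_derivative 1) (at t)"
    by (auto intro!: derivative_eq_intros)
  from vector_diff_chain_at[OF this g] have "((\<lambda>s. \<Psi> (s - t) (\<Psi> t y)) has_vector_derivative X (\<Psi> t y)) (at t)"
    by (simp add: o_def)
  then show ?thesis by (simp add: flow_add[symmetric])
qed

text \<open>Along any integral curve \<open>y\<close>, \<open>\<Psi> (- t) (y t)\<close> is stationary, because the flow preserves its
  generator.\<close>

lemma pulled_back_curve_stationary:
  assumes "(y has_vector_derivative X (y s)) (at s within J)"
  shows "((\<lambda>s. \<Psi> (- s) (y s)) has_vector_derivative 0) (at s within J)"
proof -
  let ?P = "\<lambda>p. \<Psi> (fst p) (snd p)"
  let ?P' = "frechet_derivative ?P (at (- s, y s))"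
  have P: "(?P has_derivative ?P') (at (- s, y s))"
    by (rule Cinf_has_derivative[OF flow_smooth]) simp
  have lin: "linear ?P'" using P has_derivative_linear by blast
  let ?z = "\<Psi> (- s) (y s)"
  \<comment> \<open>The partial derivative of the flow in time.\<close>
  have "((\<lambda>t. (t, y s)) has_derivative (\<lambda>t. (t, 0))) (at (- s))"
    by (auto intro!: derivative_eq_intros)
  from has_derivative_compose[OF this, of ?P ?P'] P
  have "((\<lambda>t. \<Psi> t (y s)) has_derivative (\<lambda>t. ?P' (t, 0))) (at (- s))" by simp
  from fun_cong[OF has_derivative_unique[OF this flow_velocity[unfolded has_vector_derivative_def]], of 1]
  have 1: "?P' (1, 0) = X ?z" by simp
  have "((\<lambda>t. \<Psi> t (y s)) has_derivative (\<lambda>t. t *\<^sub>R X (y s))) (at 0)"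
    using flow_velocity[of "y s" 0] by (simp add: has_vector_derivative_def flow_0)
  \<comment> \<open>The partial derivative in space, in the direction of the generator. It is read
    off by commuting the two flow maps and comparing with the velocity at \<open>?z\<close>; this is
    invariance of \<open>X\<close> under the flow.\<close>
  then have "((\<lambda>t. (- s, \<Psi> t (y s))) has_derivative (\<lambda>t. (0, t *\<^sub>R X (y s)))) (at 0)"
    by (auto intro!: derivative_eq_intros)
  from has_derivative_compose[OF this, of ?P ?P'] P
  have "((\<lambda>t. \<Psi> (- s) (\<Psi> t (y s))) has_derivative (\<lambda>t. ?P' (0, t *\<^sub>R X (y s)))) (at 0)"
    by (simp add: flow_0)
  moreover have "\<Psi> (- s) (\<Psi> t (y s)) = \<Psi> t ?z" for t
    by (metis flow_add add.commute)
  ultimately have 2: "((\<lambda>t. \<Psi> t ?z) has_derivative (\<lambda>t. ?P' (0, t *\<^sub>R X (y s)))) (at 0)" by simp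
  have "((\<lambda>t. \<Psi> t ?z) has_derivative (\<lambda>t. t *\<^sub>R X ?z)) (at 0)"
    using flow_velocity[of ?z 0] by (simp add: has_vector_derivative_def flow_0)
  from fun_cong[OF has_derivative_unique[OF 2 this], of 1] have 3: "?P' (0, X (y s)) = X ?z" by simp
  \<comment> \<open>The curve (- s, y s) has velocity (-1, X (y s)), on which the two contributions
    cancel.\<close>
  have "?P' ((-1) *\<^sub>R (1, 0) + (0, X (y s))) = (-1) *\<^sub>R ?P' (1, 0) + ?P' (0, X (y s))"
    by (simp only: linear_add[OF lin] linear_scale[OF lin])
  then have 4: "?P' (- 1, X (y s)) = 0"
    using 1 3 by simp
  have "((\<lambda>s. (- s, y s)) has_derivative (\<lambda>k. (- k, k *\<^sub>R X (y s)))) (at s within J)"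
    using assms by (auto intro!: derivative_eq_intros simp: has_vector_derivative_def)
  from has_derivative_compose[OF this P]
  have "((\<lambda>s. \<Psi> (- s) (y s)) has_derivative (\<lambda>k. ?P' (- k, k *\<^sub>R X (y s)))) (at s within J)" by simp
  moreover have "?P' (- k, k *\<^sub>R X (y s)) = k *\<^sub>R 0" for k
    using linear_scale[OF lin, of k "(- 1, X (y s))"] by (simp add: 4)
  ultimately show ?thesis unfolding has_vector_derivative_def by simp
qed

lemma H_zero_Out: "z \<in> Out \<Longrightarrow> H z = 0"
  using Out_fst h_Out by (auto simp: lift_fun_def)

lemma ham_vf_Dom:
  assumes "z \<in> Dom"
  shows "ham_vf TN (canonical_symplectic_form N) H z = coord_vec TN (CC c) z (X (snd (CC c) z))"
  unfolding X_def
proof (rule ham_vf_CC[OF c assms])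
  show "((H \<circ> cinv (CC c)) has_derivative (\<bullet>) (G (snd (CC c) z))) (at (snd (CC c) z))"
    by (rule has_derivative_transform_within_open[OF h_derivative T.open_image[OF CC_atlas]])
      (use assms in \<open>auto simp: lift_fun_def T.cinv_chart[OF CC_atlas]\<close>)
qed

lemma ham_vf_Out:
  assumes "z \<in> Out"
  shows "ham_vf TN (canonical_symplectic_form N) H z = (\<lambda>_. 0)"
proof -
  have "z \<in> pts TN" using assms by simp
  then obtain d where d: "d \<in> atlas N" "z \<in> fst (CC d)"
    using charts_at_CC_E T.chart_at_in by metis
  then have dT: "CC d \<in> atlas TN" by (simp add: atlas_TN)
  have "((H \<circ> cinv (CC d)) has_derivative (\<bullet>) 0) (at (snd (CC d) z))"
  proof (rule has_derivative_transform_within_open[OF _ T.open_chart_image[OF dT openin_Out]])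
    have "(\<bullet>) 0 = (\<lambda>_ :: 'e \<times> 'e. 0)" by auto
    then show "((\<lambda>y. 0) has_derivative (\<bullet>) 0) (at (snd (CC d) z))" by simp
    show "snd (CC d) z \<in> snd (CC d) ` (fst (CC d) \<inter> Out)" using d assms by blast
    fix y assume "y \<in> snd (CC d) ` (fst (CC d) \<inter> Out)"
    then have "cinv (CC d) y \<in> Out" using T.cinv_chart[OF dT] by auto
    then show "0 = (H \<circ> cinv (CC d)) y" using H_zero_Out by simp
  qed
  from ham_vf_CC[OF d this] show ?thesis
    using T.coord_vec_0[OF CC_charts_at[OF d]] by (simp add: zero_prod_def[symmetric])
qed

lemma smooth_path_H: "smooth_path TN (\<lambda>_. H)"
  unfolding smooth_path_def
proof (intro ballI smooth_onI)
  fix d p assume d: "d \<in> atlas TN" and "p \<in> {0..1::real} \<times> snd d ` fst d"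
  then obtain z where z: "z \<in> fst d" "snd p = snd d z" by auto
  have zp: "z \<in> pts TN" using z d T.dom_subset by blast
  show "\<exists>W g. open W \<and> p \<in> W \<and> Cinf W g \<and>
      (\<forall>y\<in>{0..1} \<times> snd d ` fst d \<inter> W. g y = (case y of (t, y) \<Rightarrow> H (cinv d y)))"
  proof (cases "z \<in> Dom")
    case True
    \<comment> \<open>The Hamiltonian is autonomous, so the local extension beyond the time interval
      may use all real times.\<close>
    let ?O = "snd d ` (fst d \<inter> Dom)"
    have op: "open (UNIV \<times> ?O :: (real \<times> _) set)"
      using T.open_overlap[OF d CC_atlas] by (simp add: open_Times)
    have "Cinf (UNIV \<times> ?O) (\<lambda>p::real \<times> _. (snd (CC c) \<circ> cinv d) (snd p))"
      by (rule Cinf_compose[OF T.trans_smooth[OF d CC_atlas] Cinf_snd[OF Cinf_id]])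
        (use op T.open_overlap[OF d CC_atlas] in auto)
    then have "Cinf (UNIV \<times> ?O) (\<lambda>p::real \<times> _. h ((snd (CC c) \<circ> cinv d) (snd p)))"
      by (rule Cinf_compose_UNIV[OF h_smooth _ op])
    moreover have "h ((snd (CC c) \<circ> cinv d) (snd y)) = (case y of (t, y) \<Rightarrow> H (cinv d y))"
      if "y \<in> UNIV \<times> ?O" for y :: "real \<times> _"
      using that T.cinv_chart[OF d] by (auto simp: lift_fun_def)
    moreover have "p \<in> UNIV \<times> ?O" using z True by (cases p) auto
    ultimately show ?thesis using op
      by (intro exI[of _ "UNIV \<times> ?O"] exI[of _ "\<lambda>p. h ((snd (CC c) \<circ> cinv d) (snd p))"]) blast
  next
    case False
    then have zO: "z \<in> Out" using Dom_Out zp by blast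
    let ?O = "snd d ` (fst d \<inter> Out)"
    have op: "open (UNIV \<times> ?O :: (real \<times> _) set)"
      using T.open_chart_image[OF d openin_Out] by (simp add: open_Times)
    moreover have "0 = (case y of (t, y) \<Rightarrow> H (cinv d y))" if "y \<in> UNIV \<times> ?O" for y :: "real \<times> _"
    proof -
      have "cinv d (snd y) \<in> Out" using that T.cinv_chart[OF d] by auto
      then show ?thesis using H_zero_Out by (simp add: split_beta)
    qed
    moreover have "p \<in> UNIV \<times> ?O" using z zO by (cases p) auto
    ultimately show ?thesis
      by (intro exI[of _ "UNIV \<times> ?O"] exI[of _ "\<lambda>p. 0"]) (use Cinf_const in blast)
  qed
qed

text \<open>On \<open>Dom\<close> the velocity is known in the chart \<open>CC c\<close> and
  transferred to the others; on \<open>Out\<close> the curve rests and the vector field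
  vanishes.\<close>

lemma is_ham_flow_lift:
  "is_ham_flow TN (canonical_symplectic_form N) (\<lambda>_. H) (\<lambda>t. lift (\<Psi> t))"
  unfolding is_ham_flow_def
proof (intro conjI ballI)
  fix t :: real
  show "diffeo TN (lift (\<Psi> t))"
    by (rule diffeo_lift[where F'="\<Psi> (- t)"])
      (simp_all add: flow_supported flow_smooth_space flow_inverse)
next
  fix z
  have "\<Psi> 0 = (\<lambda>y. y)" using flow_0 by auto
  then show "lift (\<Psi> 0) z = z" by (simp add: lift_ident)
next
  fix z assume z: "z \<in> pts TN"
  show cont: "continuous_map (top_of_set {0..1}) (mtop TN) (\<lambda>t. lift (\<Psi> t) z)"
  proof (cases "z \<in> Dom")
    case True
    show ?thesis unfolding continuous_map_def
    proof (intro conjI allI impI)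
      show "(\<lambda>t. lift (\<Psi> t) z) \<in> topspace (top_of_set {0..1}) \<rightarrow> pts TN"
        using lift_pts[OF flow_supported z] by auto
      fix A assume A: "openin (mtop TN) A"
      let ?W = "snd (CC c) ` (Dom \<inter> A)"
      have "lift (\<Psi> t) z \<in> A \<longleftrightarrow> \<Psi> t (snd (CC c) z) \<in> ?W" for t
        using lift_Dom[OF flow_supported True, of t] inj_onD[OF T.inj_chart[OF CC_atlas]]
        by (smt (verit) IntE IntI image_iff)
      then have eq: "{t \<in> topspace (top_of_set {0..1}). lift (\<Psi> t) z \<in> A} =
          {0..1} \<inter> (\<lambda>t. \<Psi> t (snd (CC c) z)) -` ?W" by auto
      have "continuous_on UNIV (\<lambda>t. \<Psi> t (snd (CC c) z))"
        by (intro continuous_at_imp_continuous_on ballI has_vector_derivative_continuous[OF flow_velocity])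
      then have "open ((\<lambda>t. \<Psi> t (snd (CC c) z)) -` ?W)"
        using T.open_chart_image[OF CC_atlas A] by (simp add: open_vimage)
      then show "openin (top_of_set {0..1}) {t \<in> topspace (top_of_set {0..1}). lift (\<Psi> t) z \<in> A}"
        unfolding eq by (simp add: openin_open_Int)
    qed
  qed (use z in \<open>simp add: lift_def\<close>)
  fix t d assume t: "t \<in> {0..1::real}" and d: "d \<in> charts_at TN (lift (\<Psi> t) z)"
  show "((\<lambda>s. snd d (lift (\<Psi> s) z)) has_vector_derivative
      ham_vf TN (canonical_symplectic_form N) H (lift (\<Psi> t) z) d) (at t within {0..1})"
  proof (cases "z \<in> Dom")
    case True
    note L = lift_Dom[OF flow_supported True]
    have C: "CC c \<in> charts_at TN (lift (\<Psi> t) z)"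
      using CC_charts_at[OF c] L by simp
    show ?thesis unfolding ham_vf_Dom[OF L(1)] L(2)
    proof (rule T.velocity_change_chart[OF cont t C d T.coord_vec_tangent[OF C]])
      show "((\<lambda>s. snd (CC c) (lift (\<Psi> s) z)) has_vector_derivative
        coord_vec TN (CC c) (lift (\<Psi> t) z) (X (\<Psi> t (snd (CC c) z))) (CC c)) (at t within {0..1})"
        unfolding T.coord_vec_self[OF C] L(2)
        by (rule has_vector_derivative_at_within[OF flow_velocity])
    qed
  next
    case False
    then have "z \<in> Out" using Dom_Out z by blast
    then show ?thesis
      by (simp add: lift_Out[OF flow_supported] ham_vf_Out)
  qed
qed

lemma constant_if_velocity_zero:
  fixes k :: "real \<Rightarrow> 'b::real_normed_vector"
  assumes "\<And>s. s \<in> {0..1} \<Longrightarrow> dist s t < d \<Longrightarrow> (k has_vector_derivative 0) (at s within {0..1})"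
    "s \<in> {0..1}" "dist s t < d" "t \<in> {0..1}" "d > 0"
  shows "k s = k t"
proof -
  let ?J = "{0..1} \<inter> ball t d"
  have "\<exists>c. \<forall>x\<in>?J. k x = c"
  proof (rule has_derivative_zero_constant)
    show "convex ?J" by (intro convex_Int) auto
    show "(k has_derivative (\<lambda>_. 0)) (at x within ?J)" if "x \<in> ?J" for x
      using has_vector_derivative_within_subset[OF assms(1), of x ?J] that
      by (auto simp: has_vector_derivative_def dist_commute)
  qed
  then show ?thesis using assms by (metis Int_iff centre_in_ball dist_commute mem_ball)
qed

text \<open>An integral curve pulled back along the explicit flow is locally constant, hence
  constant on the connected interval. This makes the description in \<open>ham_map\<close> well
  defined.\<close>

lemma ham_flow_unique:
  assumes "is_ham_flow TN (canonical_symplectic_form N) (\<lambda>_. H) \<phi>"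
  shows "\<phi> 1 = lift (\<Psi> 1)"
proof
  fix x
  show "\<phi> 1 x = lift (\<Psi> 1) x"
  proof (cases "x \<in> pts TN")
    case False
    \<comment> \<open>Off the points of the manifold both maps are the identity by the convention in
      \<open>diffeo\<close>.\<close>
    then show ?thesis
      using assms is_ham_flow_lift unfolding is_ham_flow_def diffeo_def by force
  next
    case x: True
    define \<gamma> where "\<gamma> t = \<phi> t x" for t
    have \<gamma>0: "\<gamma> 0 = x" and cont: "continuous_map (top_of_set {0..1}) (mtop TN) \<gamma>"
      and vel: "\<And>t d. t \<in> {0..1} \<Longrightarrow> d \<in> charts_at TN (\<gamma> t) \<Longrightarrow>
         ((\<lambda>s. snd d (\<gamma> s)) has_vector_derivative
           ham_vf TN (canonical_symplectic_form N) H (\<gamma> t) d) (at t within {0..1})"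
      using assms x unfolding is_ham_flow_def \<gamma>_def[abs_def] by auto
    have \<gamma>_pts: "\<gamma> t \<in> pts TN" if "t \<in> {0..1}" for t
      using cont that unfolding continuous_map_def by auto
    define \<delta> where "\<delta> t = lift (\<Psi> (- t)) (\<gamma> t)" for t
    have loc: "\<exists>d>0. \<forall>s\<in>{0..1}. dist s t < d \<longrightarrow> \<delta> s = \<delta> t" if t: "t \<in> {0..1}" for t
    proof (cases "\<gamma> t \<in> Dom")
      case True
      obtain d where d: "d > 0" "\<And>s. s \<in> {0..1} \<Longrightarrow> dist s t < d \<Longrightarrow> \<gamma> s \<in> Dom"
        using T.curve_locally_in[OF cont t T.openin_dom[OF CC_atlas] True] by blast
      let ?k = "\<lambda>s. \<Psi> (- s) (snd (CC c) (\<gamma> s))"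
      have "(?k has_vector_derivative 0) (at s within {0..1})" if s: "s \<in> {0..1}" "dist s t < d" for s
      proof (rule pulled_back_curve_stationary)
        have C: "CC c \<in> charts_at TN (\<gamma> s)" using CC_charts_at[OF c d(2)[OF s]] .
        show "((\<lambda>s. snd (CC c) (\<gamma> s)) has_vector_derivative X (snd (CC c) (\<gamma> s))) (at s within {0..1})"
          using vel[OF s(1) C] by (simp add: ham_vf_Dom[OF d(2)[OF s]] T.coord_vec_self[OF C])
      qed
      from constant_if_velocity_zero[where k="?k", OF this]
      have "?k s = ?k t" if "s \<in> {0..1}" "dist s t < d" for s
        using that t d(1) by blast
      then have "\<delta> s = \<delta> t" if "s \<in> {0..1}" "dist s t < d" for s
        using that d(2) True by (simp add: \<delta>_def lift_def)
      then show ?thesis using d(1) by blast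
    next
      case False
      then have O: "\<gamma> t \<in> Out" using Dom_Out \<gamma>_pts[OF t] by blast
      \<comment> \<open>Here \<open>CC c\<close> may not contain the curve. Any chart will do, since
        the vector field vanishes on \<open>Out\<close>, so the curve is locally constant, and the
        lifted flow acts trivially.\<close>
      obtain ch where ch: "ch \<in> charts_at TN (\<gamma> t)" using T.chart_at_in \<gamma>_pts[OF t] by blast
      note ch' = T.charts_atD[OF ch]
      have A: "openin (mtop TN) (fst ch \<inter> Out)" using T.openin_dom[OF ch'(1)] openin_Out by blast
      have "\<gamma> t \<in> fst ch \<inter> Out" using O ch' by blast
      then obtain d where d: "d > 0" "\<And>s. s \<in> {0..1} \<Longrightarrow> dist s t < d \<Longrightarrow> \<gamma> s \<in> fst ch \<inter> Out"
        using T.curve_locally_in[OF cont t A] by blast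
      let ?k = "\<lambda>s. snd ch (\<gamma> s)"
      have "(?k has_vector_derivative 0) (at s within {0..1})" if s: "s \<in> {0..1}" "dist s t < d" for s
      proof -
        have "ch \<in> charts_at TN (\<gamma> s)" "\<gamma> s \<in> Out" using d(2)[OF s] T.charts_atI[OF ch'(1)] by auto
        then show ?thesis using vel[OF s(1), of ch] by (simp add: ham_vf_Out)
      qed
      from constant_if_velocity_zero[where k="?k", OF this]
      have "?k s = ?k t" if "s \<in> {0..1}" "dist s t < d" for s
        using that t d(1) by blast
      then have "\<gamma> s = \<gamma> t" if "s \<in> {0..1}" "dist s t < d" for s
        using that d(2)[OF that] inj_onD[OF T.inj_chart[OF ch'(1)]] ch'(2) by blast
      then have "\<delta> s = \<delta> t" if "s \<in> {0..1}" "dist s t < d" for s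
        using that O by (simp add: \<delta>_def lift_Out[OF flow_supported])
      then show ?thesis using d(1) by blast
    qed
    have "\<delta> 1 = \<delta> 0"
    proof (rule connected_local_const[of "{0..1::real}"])
      show "\<forall>a\<in>{0..1::real}. \<forall>\<^sub>F b in at a within {0..1}. \<delta> a = \<delta> b"
        using loc unfolding eventually_at by metis
    qed auto
    also have "\<delta> 0 = x"
      using is_ham_flow_lift x unfolding \<delta>_def \<gamma>0 is_ham_flow_def by simp
    finally have "lift (\<Psi> 1) (lift (\<Psi> (- 1)) (\<gamma> 1)) = lift (\<Psi> 1) x"
      by (simp add: \<delta>_def)
    then show ?thesis
      by (simp add: lift_lift[OF flow_supported flow_supported] flow_inverse lift_ident \<gamma>_def)
  qed
qed

lemma H_in_Ham: "(\<lambda>_. H) \<in> Ham TN (canonical_symplectic_form N)"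
  unfolding Ham_def using smooth_path_H is_ham_flow_lift by blast

lemma ham_map_H: "ham_map TN (canonical_symplectic_form N) (\<lambda>_. H) = lift (\<Psi> 1)"
  unfolding ham_map_def using is_ham_flow_lift ham_flow_unique by (intro the_equality) blast+

lemma lift_in_ham_diffeos: "lift (\<Psi> 1) \<in> ham_diffeos TN (canonical_symplectic_form N)"
  unfolding ham_diffeos_def using H_in_Ham ham_map_H by (metis imageI)

end

section \<open>Explicit Hamiltonians\<close>

definition poly_exp :: "real poly \<Rightarrow> real \<Rightarrow> real" where
  "poly_exp p x = (if x > 0 then poly p (1 / x) * exp (- (1 / x)) else 0)"

text \<open>Substituting u = 1/x, the exponential beats every power of u at infinity.\<close>

lemma poly_exp_tendsto_0: "((\<lambda>x::real. poly p (1 / x) * exp (- (1 / x))) \<longlongrightarrow> 0) (at_right 0)"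
proof -
  have "((\<lambda>u::real. \<Sum>i\<le>degree p. coeff p i * (u ^ i / exp u)) \<longlongrightarrow> (\<Sum>i\<le>degree p. coeff p i * 0)) at_top"
    by (intro tendsto_sum tendsto_mult tendsto_const tendsto_power_div_exp_0)
  moreover have "(\<Sum>i\<le>degree p. coeff p i * (u ^ i / exp u)) = poly p u * exp (- u)" for u
    by (simp add: poly_altdef exp_minus sum_distrib_right divide_inverse mult.assoc)
  ultimately have "((\<lambda>u::real. poly p u * exp (- u)) \<longlongrightarrow> 0) at_top" by simp
  from filterlim_compose[OF this filterlim_inverse_at_top_right] show ?thesis
    by (simp add: inverse_eq_divide)
qed

text \<open>With u = 1/x, the derivative of p(u) exp(-u) in x is u^2 (p(u) - p'(u)) exp(-u), and
  \<open>[:0, 0, 1:]\<close> is u^2. So the family is closed under differentiation.\<close>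

lemma poly_exp_derivative:
  "(poly_exp p has_real_derivative poly_exp ([:0, 0, 1:] * (p - pderiv p)) x) (at x)"
proof -
  consider "x > 0" | "x < 0" | "x = 0" by linarith
  then show ?thesis
  proof cases
    case 1
    have "((\<lambda>x. 1 / x) has_real_derivative - 1 / x\<^sup>2) (at x)"
      using 1 by (auto intro!: derivative_eq_intros simp: power2_eq_square)
    note inv = this
    have "((\<lambda>x. poly p (1 / x) * exp (- (1 / x))) has_real_derivative
        poly p (1 / x) * (exp (- (1 / x)) * - (- 1 / x\<^sup>2)) +
        poly (pderiv p) (1 / x) * (- 1 / x\<^sup>2) * exp (- (1 / x))) (at x)"
      by (intro DERIV_mult' DERIV_chain2[OF DERIV_exp] DERIV_minus DERIV_chain2[OF poly_DERIV] inv)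
    then have "((\<lambda>x. poly p (1 / x) * exp (- (1 / x))) has_real_derivative
        poly_exp ([:0, 0, 1:] * (p - pderiv p)) x) (at x)"
      by (rule DERIV_cong) (use 1 in \<open>simp add: poly_exp_def field_simps power2_eq_square\<close>)
    then show ?thesis
      by (rule has_field_derivative_transform_within_open[of _ _ _ "{0<..}"])
        (use 1 in \<open>auto simp: poly_exp_def\<close>)
  next
    case 2
    have "((\<lambda>x. 0) has_real_derivative 0) (at x)" by simp
    then have "(poly_exp p has_real_derivative 0) (at x)"
      by (rule has_field_derivative_transform_within_open[of _ _ _ "{..<0}"])
        (use 2 in \<open>auto simp: poly_exp_def\<close>)
    then show ?thesis using 2 by (simp add: poly_exp_def)
  next
    case 3
    have "((\<lambda>y. poly_exp p y / y) \<longlongrightarrow> 0) (at_left 0)"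
      by (rule tendsto_eventually) (auto simp: eventually_at_filter poly_exp_def)
    \<comment> \<open>Dividing by y multiplies the polynomial in 1/y by its variable, which is
      \<open>pCons 0 p\<close>.\<close>
    moreover have "((\<lambda>y. poly_exp p y / y) \<longlongrightarrow> 0) (at_right 0)"
      by (rule Lim_transform_eventually[OF poly_exp_tendsto_0[of "pCons 0 p"]])
        (auto simp: eventually_at_filter poly_exp_def)
    ultimately have "((\<lambda>y. poly_exp p y / y) \<longlongrightarrow> 0) (at 0)" by (rule filterlim_split_at)
    then show ?thesis using 3 by (simp add: has_field_derivative_iff poly_exp_def)
  qed
qed

lemma Cinf_poly_exp: "Cinf UNIV (poly_exp p)"
proof -
  have "Cinf UNIV ((\<lambda>n. poly_exp (((\<lambda>p. [:0, 0, 1:] * (p - pderiv p)) ^^ n) p)) 0)"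
    by (rule Cinf_derivs_real) (simp del: mult_pCons_left add: poly_exp_derivative)
  then show ?thesis by simp
qed

text \<open>The standard function exp(-1/x) on positive numbers, followed by its derivative: for p =
  1 the polynomial u^2 (p - p') is u^2.\<close>

definition flat :: "real \<Rightarrow> real" where "flat = poly_exp 1"
definition flat' :: "real \<Rightarrow> real" where "flat' = poly_exp [:0, 0, 1:]"

lemma Cinf_flat: "Cinf UNIV flat" and Cinf_flat': "Cinf UNIV flat'"
  by (simp_all add: flat_def flat'_def Cinf_poly_exp)

lemma flat_derivative: "(flat has_real_derivative flat' x) (at x)"
  using poly_exp_derivative[of 1 x] by (simp add: flat_def flat'_def)

lemma flat_nonpos: "x \<le> 0 \<Longrightarrow> flat x = 0" "x \<le> 0 \<Longrightarrow> flat' x = 0"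
  by (simp_all add: flat_def flat'_def poly_exp_def)

lemma flat_pos: "x > 0 \<Longrightarrow> flat x > 0"
  by (simp add: flat_def poly_exp_def)

lemma flat_mono: "x \<le> y \<Longrightarrow> flat x \<le> flat y"
  by (auto simp: flat_def poly_exp_def divide_simps)

text \<open>The bound 2, from the quadratic Taylor estimate of the exponential, will keep half a
  rotation angle below pi.\<close>

lemma flat'_bounds:
  assumes "x > 0"
  shows "0 < flat' x" "flat' x < 2"
proof -
  let ?u = "1 / x"
  have u: "?u > 0" using assms by simp
  have eq: "flat' x = ?u\<^sup>2 / exp ?u"
    using assms by (simp add: flat'_def poly_exp_def exp_minus power2_eq_square field_simps)
  show "0 < flat' x" unfolding eq using u by simp
  have "1 + ?u + ?u\<^sup>2 / 2 \<le> exp ?u" using u by (intro exp_lower_Taylor_quadratic) simp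
  then have "?u\<^sup>2 < 2 * exp ?u" using u by linarith
  then show "flat' x < 2" unfolding eq by (simp add: divide_less_eq)
qed

text \<open>A smooth step from 1 to 0 between a and b. The inner difference is at its maximum
  \<open>flat (b - a)\<close> for s up to a and nonpositive from b on; the outer \<open>flat\<close>
  cuts it off. The denominator is constant, so smoothness needs no quotient rule.\<close>

definition plateau :: "real \<Rightarrow> real \<Rightarrow> real \<Rightarrow> real" where
  "plateau a b s = flat (flat (b - a) - flat (s - a)) / flat (flat (b - a))"

lemma Cinf_plateau: "Cinf UNIV (plateau a b)"
proof -
  have "Cinf UNIV (\<lambda>s. flat (flat (b - a) - flat (s - a)) * (1 / flat (flat (b - a))))"
    by (intro Cinf_mult Cinf_compose_UNIV[OF Cinf_flat] Cinf_diff Cinf_const Cinf_id open_UNIV)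
  then show ?thesis by (simp add: plateau_def[abs_def])
qed

lemma plateau_1: "a < b \<Longrightarrow> s \<le> a \<Longrightarrow> plateau a b s = 1"
  using flat_pos[of "flat (b - a)"] flat_pos[of "b - a"] by (simp add: plateau_def flat_nonpos)

lemma plateau_0: "b \<le> s \<Longrightarrow> plateau a b s = 0"
  using flat_mono[of "b - a" "s - a"] by (simp add: plateau_def flat_nonpos)

section \<open>Rotations and radial Hamiltonians\<close>

text \<open>The complex structure that turns a gradient into its Hamiltonian vector field.\<close>

definition Jm :: "'e::euclidean_space \<times> 'e \<Rightarrow> 'e \<times> 'e" where
  "Jm v = (snd v, - fst v)"

lemma bounded_linear_Jm: "bounded_linear Jm"
  unfolding Jm_def[abs_def]
  by (intro bounded_linear_Pair bounded_linear_snd bounded_linear_minus bounded_linear_fst)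

lemma Jm_simps: "Jm (Jm v) = - v" "Jm v \<bullet> v = 0" "v \<bullet> Jm v = 0" "Jm v \<bullet> Jm v = v \<bullet> v"
  by (auto simp: Jm_def inner_prod_def inner_commute prod_eq_iff)

text \<open>The exponential of \<open>a\<close> times \<open>Jm\<close>, since the square of
  \<open>Jm\<close> is minus the identity.\<close>

definition rot :: "real \<Rightarrow> 'e::euclidean_space \<times> 'e \<Rightarrow> 'e \<times> 'e" where
  "rot a v = cos a *\<^sub>R v + sin a *\<^sub>R Jm v"

lemma Jm_linear: "Jm (v + w) = Jm v + Jm w" "Jm (k *\<^sub>R v) = k *\<^sub>R Jm v"
  by (auto simp: Jm_def)

lemma rot_add: "rot a (rot b v) = rot (a + b) v"
  by (simp add: rot_def Jm_linear Jm_simps cos_add sin_add scaleR_add_right scaleR_add_left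
      scaleR_diff_left scaleR_diff_right)

lemma inner_rot: "rot a v \<bullet> rot a v = v \<bullet> v"
proof -
  have "rot a v \<bullet> rot a v = ((cos a)\<^sup>2 + (sin a)\<^sup>2) * (v \<bullet> v)"
    by (simp only: rot_def inner_add_left inner_add_right inner_scaleR_left inner_scaleR_right Jm_simps
        power2_eq_square) algebra
  then show ?thesis by simp
qed

lemma rot_0: "rot 0 v = v"
  by (simp add: rot_def)

lemma rot_eq_imp_cos:
  assumes "rot a v = v" "v \<noteq> 0"
  shows "cos a = 1"
proof -
  have "rot a v \<bullet> v = cos a * (v \<bullet> v)" by (simp add: rot_def inner_add_left Jm_simps)
  then show ?thesis using assms by simp
qed

definition rad_h :: "real \<Rightarrow> 'e::euclidean_space \<times> 'e \<Rightarrow> 'e \<times> 'e \<Rightarrow> real" where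
  "rad_h r z y = flat (r\<^sup>2 - (y - z) \<bullet> (y - z))"

text \<open>The gradient of \<open>rad_h r z\<close> at y is this factor times y - z; the -2 comes
  from the chain rule.\<close>

definition speed :: "real \<Rightarrow> 'e::euclidean_space \<times> 'e \<Rightarrow> 'e \<times> 'e \<Rightarrow> real" where
  "speed r z y = - 2 * flat' (r\<^sup>2 - (y - z) \<bullet> (y - z))"

text \<open>The Hamiltonian field is \<open>speed\<close> times \<open>Jm (y - z)\<close>. Its speed
  depends only on the distance to z, which rotations preserve, so each orbit turns at a constant
  rate.\<close>

definition rad_flow :: "real \<Rightarrow> 'e::euclidean_space \<times> 'e \<Rightarrow> real \<Rightarrow> 'e \<times> 'e \<Rightarrow> 'e \<times> 'e" where
  "rad_flow r z t y = z + rot (t * speed r z y) (y - z)"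

lemma sq_le_inner_of_fst:
  fixes y z :: "'e::euclidean_space \<times> 'e"
  assumes "r \<le> dist (fst y) (fst z)" "r > 0"
  shows "r\<^sup>2 \<le> (y - z) \<bullet> (y - z)"
proof -
  have "r\<^sup>2 \<le> (norm (fst (y - z)))\<^sup>2" using assms by (intro power_mono) (auto simp: dist_norm)
  also have "\<dots> \<le> (y - z) \<bullet> (y - z)" by (simp add: inner_prod_def power2_norm_eq_inner)
  finally show ?thesis .
qed

lemma rad_flow_outside:
  assumes "r\<^sup>2 \<le> (y - z) \<bullet> (y - z)"
  shows "rad_flow r z t y = y" "rad_h r z y = 0"
  using assms by (simp_all add: rad_flow_def speed_def rad_h_def flat_nonpos rot_0)

lemma speed_rad_flow: "speed r z (rad_flow r z t y) = speed r z y"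
  by (simp add: speed_def rad_flow_def inner_rot)

lemma Cinf_speed: "Cinf UNIV (speed r z)"
  unfolding speed_def[abs_def]
  by (intro Cinf_mult Cinf_compose_UNIV[OF Cinf_flat'] Cinf_diff Cinf_inner Cinf_const Cinf_id open_UNIV)

lemma rad_chart_flow:
  assumes "supported_in_chart N c B" "ball (fst z) r \<subseteq> B" "r > 0"
  shows "chart_flow N c B (rad_h r z) (\<lambda>y. speed r z y *\<^sub>R (y - z)) (rad_flow r z)"
proof -
  interpret supported_in_chart N c B by fact
  have far: "r\<^sup>2 \<le> (y - z) \<bullet> (y - z)" if "fst y \<notin> B" for y
    using that assms(2,3) by (intro sq_le_inner_of_fst) (auto simp: dist_commute subset_iff not_less)
  show ?thesis
  proof
    show "Cinf UNIV (rad_h r z)"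
      unfolding rad_h_def[abs_def]
      by (intro Cinf_compose_UNIV[OF Cinf_flat] Cinf_diff Cinf_inner Cinf_const Cinf_id open_UNIV)
    show "(rad_h r z has_derivative (\<bullet>) (speed r z y *\<^sub>R (y - z))) (at y)" for y
    proof -
      have "((\<lambda>y. r\<^sup>2 - (y - z) \<bullet> (y - z)) has_derivative (\<lambda>w. - 2 * ((y - z) \<bullet> w))) (at y)"
        by (auto intro!: derivative_eq_intros simp: inner_commute algebra_simps)
      from has_derivative_compose[OF this flat_derivative[unfolded has_field_derivative_def]]
      show ?thesis
        unfolding rad_h_def[abs_def]
        by (rule has_derivative_eq_rhs) (auto simp: speed_def)
    qed
    show "rad_h r z y = 0" "rad_flow r z t y = y" if "fst y \<notin> B" for y t
      using rad_flow_outside[OF far[OF that]] by auto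
    show "Cinf UNIV (\<lambda>p. rad_flow r z (fst p) (snd p))"
      unfolding rad_flow_def rot_def
      by (intro Cinf_add Cinf_scaleR Cinf_compose_UNIV[OF Cinf_cos] Cinf_compose_UNIV[OF Cinf_sin]
          Cinf_compose_linear[OF bounded_linear_Jm] Cinf_mult Cinf_compose_UNIV[OF Cinf_speed]
          Cinf_diff Cinf_const Cinf_id Cinf_fst Cinf_snd open_UNIV)
    show "rad_flow r z 0 y = y" for y by (simp add: rad_flow_def rot_0)
    \<comment> \<open>Angles add because the speed is the same at both points.\<close>
    show "rad_flow r z (s + t) y = rad_flow r z s (rad_flow r z t y)" for s t y
      using speed_rad_flow[of r z t y] by (simp add: rad_flow_def rot_add distrib_right)
    show "((\<lambda>t. rad_flow r z t y) has_vector_derivative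
        (snd (speed r z y *\<^sub>R (y - z)), - fst (speed r z y *\<^sub>R (y - z)))) (at 0)" for y
    proof -
      have "((\<lambda>t. rad_flow r z t y) has_vector_derivative speed r z y *\<^sub>R Jm (y - z)) (at 0)"
        unfolding rad_flow_def rot_def has_vector_derivative_def
        by (auto intro!: derivative_eq_intros)
      then show ?thesis by (simp only: Jm_def scaleR_Pair fst_scaleR snd_scaleR scaleR_minus_right)
    qed
  qed
qed

text \<open>A fixed point off the centre forces cos(2a) = 1, hence sin a = 0, for a the value of
  \<open>flat'\<close>. But 0 < a < 2 and 2 does not exceed pi, so sin a is positive.\<close>

lemma rad_flow_moves:
  assumes "y \<noteq> z" "(y - z) \<bullet> (y - z) < r\<^sup>2"
  shows "rad_flow r z 1 y \<noteq> y"
proof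
  let ?a = "flat' (r\<^sup>2 - (y - z) \<bullet> (y - z))"
  assume "rad_flow r z 1 y = y"
  then have "rot (- 2 * ?a) (y - z) = y - z" by (simp add: rad_flow_def speed_def algebra_simps)
  then have "cos (2 * ?a) = 1" using rot_eq_imp_cos[of "- 2 * ?a" "y - z"] assms(1) by simp
  then have "sin ?a = 0" by (simp add: cos_double_sin)
  moreover have "0 < ?a" "?a < 2" using flat'_bounds assms(2) by simp_all
  then have "sin ?a > 0" using pi_ge_two by (intro sin_gt_zero) auto
  ultimately show False by simp
qed

section \<open>Fibrewise translations\<close>

definition gradient :: "('e::euclidean_space \<Rightarrow> real) \<Rightarrow> 'e \<Rightarrow> 'e" where
  "gradient f q = (\<Sum>b\<in>Basis. frechet_derivative f (at q) b *\<^sub>R b)"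

lemma gradient_eqI:
  assumes "(f has_derivative (\<lambda>w. a \<bullet> w)) (at q)"
  shows "gradient f q = a"
proof -
  have "frechet_derivative f (at q) = (\<lambda>w. a \<bullet> w)"
    using frechet_derivative_at[OF assms] by simp
  then show ?thesis by (simp add: gradient_def euclidean_representation)
qed

lemma Cinf_has_gradient:
  assumes "Cinf UNIV f"
  shows "(f has_derivative (\<lambda>w. gradient f q \<bullet> w)) (at q)"
proof -
  note d = Cinf_has_derivative[OF assms UNIV_I, of q]
  have "frechet_derivative f (at q) w = gradient f q \<bullet> w" for w
    using linear_expand_Basis[OF has_derivative_linear[OF d], of w]
    by (simp add: gradient_def inner_sum_left inner_commute[of w] mult.commute)
  then have "frechet_derivative f (at q) = (\<lambda>w. gradient f q \<bullet> w)" by (rule ext)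
  with d show ?thesis by simp
qed

lemma Cinf_gradient: "Cinf UNIV f \<Longrightarrow> Cinf UNIV (gradient f)"
  unfolding gradient_def[abs_def]
  by (intro Cinf_sum Cinf_scaleR Cinf_frechet Cinf_const open_UNIV)

text \<open>The flow of - f(q): the base point rests and the momentum grows at the constant rate
  df(q).\<close>

definition fiber_shift :: "('e::euclidean_space \<Rightarrow> real) \<Rightarrow> real \<Rightarrow> 'e \<times> 'e \<Rightarrow> 'e \<times> 'e" where
  "fiber_shift f t y = (fst y, snd y + t *\<^sub>R gradient f (fst y))"

lemma fiber_shift_chart_flow:
  assumes "supported_in_chart N c B" "Cinf UNIV f" "\<And>q. q \<notin> B \<Longrightarrow> f q = 0" "closed B"
  shows "chart_flow N c B (\<lambda>y. - f (fst y)) (\<lambda>y. (- gradient f (fst y), 0)) (fiber_shift f)"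
proof -
  interpret supported_in_chart N c B by fact
  have grad0: "gradient f q = 0" if "q \<notin> B" for q
  proof (rule gradient_eqI)
    have "((\<lambda>y. 0) has_derivative (\<lambda>w. 0)) (at q)" by simp
    then show "(f has_derivative (\<lambda>w. 0 \<bullet> w)) (at q)"
      unfolding inner_zero_left
      by (rule has_derivative_transform_within_open[of _ _ _ _ "- B"]) (use that assms in auto)
  qed
  show ?thesis
  proof
    show "Cinf UNIV (\<lambda>y. - f (fst y))"
      by (intro Cinf_minus Cinf_compose_UNIV[OF assms(2)] Cinf_fst Cinf_id open_UNIV)
    show "((\<lambda>y. - f (fst y)) has_derivative (\<bullet>) (- gradient f (fst y), 0)) (at y)" for y :: "'b \<times> 'b"
    proof -
      have "((\<lambda>y. f (fst y)) has_derivative (\<lambda>w. gradient f (fst y) \<bullet> fst w)) (at y)"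
        by (rule has_derivative_compose[OF has_derivative_fst[OF has_derivative_ident]])
          (rule Cinf_has_gradient[OF assms(2)])
      from has_derivative_minus[OF this] show ?thesis
        by (rule has_derivative_eq_rhs) (auto simp: inner_prod_def)
    qed
    show "- f (fst y) = 0" "fiber_shift f t y = y" if "fst y \<notin> B" for y t
      using assms(3)[OF that] grad0[OF that] by (simp_all add: fiber_shift_def)
    show "Cinf UNIV (\<lambda>p. fiber_shift f (fst p) (snd p))"
      unfolding fiber_shift_def
      by (intro Cinf_Pair Cinf_add Cinf_scaleR Cinf_compose_UNIV[OF Cinf_gradient[OF assms(2)]]
          Cinf_fst Cinf_snd Cinf_id open_UNIV)
    show "fiber_shift f 0 y = y" for y by (simp add: fiber_shift_def)
    show "fiber_shift f (s + t) y = fiber_shift f s (fiber_shift f t y)" for s t y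
      by (simp add: fiber_shift_def scaleR_add_left)
    show "((\<lambda>t. fiber_shift f t y) has_vector_derivative
        (snd (- gradient f (fst y), 0 :: 'b), - fst (- gradient f (fst y), 0 :: 'b))) (at 0)" for y
      unfolding fiber_shift_def has_vector_derivative_def
      by (auto intro!: derivative_eq_intros)
  qed
qed

text \<open>Provides the zero Hamiltonian and the identity map through the same construction as the
  other flows.\<close>

lemma ident_chart_flow:
  assumes "supported_in_chart N c B"
  shows "chart_flow N c B (\<lambda>_. 0) (\<lambda>_. 0) (\<lambda>t y. y)"
proof -
  interpret supported_in_chart N c B by fact
  show ?thesis
  proof
    have "(\<bullet>) 0 = (\<lambda>_ :: 'b \<times> 'b. 0)" by auto
    then show "((\<lambda>_. 0) has_derivative (\<bullet>) 0) (at y)" for y :: "'b \<times> 'b" by simp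
  qed (simp_all add: Cinf_const Cinf_snd Cinf_id zero_prod_def[symmetric])
qed

text \<open>A function whose gradient is the covector \<open>a\<close> near \<open>q\<close>.\<close>

definition linear_bump :: "real \<Rightarrow> real \<Rightarrow> 'e::euclidean_space \<Rightarrow> 'e \<Rightarrow> 'e \<Rightarrow> real" where
  "linear_bump r R q a x = (a \<bullet> (x - q)) * plateau (r\<^sup>2) (R\<^sup>2) ((x - q) \<bullet> (x - q))"

lemma linear_bump:
  assumes "0 < r" "r < R"
  shows "Cinf UNIV (linear_bump r R q a)"
    "x \<notin> cball q R \<Longrightarrow> linear_bump r R q a x = 0"
    "x \<in> ball q r \<Longrightarrow> gradient (linear_bump r R q a) x = a"
proof -
  show "Cinf UNIV (linear_bump r R q a)"
    unfolding linear_bump_def[abs_def]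
    by (intro Cinf_mult Cinf_inner Cinf_compose_UNIV[OF Cinf_plateau] Cinf_diff Cinf_const Cinf_id open_UNIV)
  have n: "(x - q) \<bullet> (x - q) = (dist q x)\<^sup>2" for x
    by (simp add: dist_norm power2_norm_eq_inner[symmetric] norm_minus_commute)
  show "linear_bump r R q a x = 0" if "x \<notin> cball q R"
  proof -
    have "R\<^sup>2 \<le> (dist q x)\<^sup>2" using that assms by (intro power_mono) auto
    then show ?thesis by (simp add: linear_bump_def n plateau_0)
  qed
  show "gradient (linear_bump r R q a) x = a" if "x \<in> ball q r"
  proof (rule gradient_eqI)
    have "((\<lambda>x. a \<bullet> (x - q)) has_derivative (\<lambda>w. a \<bullet> w)) (at x)"
      by (auto intro!: derivative_eq_intros)
    then show "(linear_bump r R q a has_derivative (\<lambda>w. a \<bullet> w)) (at x)"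
    proof (rule has_derivative_transform_within_open[OF _ open_ball that])
      fix x assume "x \<in> ball q r"
      then have "(dist q x)\<^sup>2 \<le> r\<^sup>2" by (intro power_mono) auto
      moreover have "r\<^sup>2 < R\<^sup>2" using assms by (intro power_strict_mono) auto
      ultimately show "a \<bullet> (x - q) = linear_bump r R q a x"
        by (simp add: linear_bump_def n plateau_1)
    qed
  qed
qed

text \<open>The rotation acts only where the base coordinate lies in \<open>ball q r\<close>. There
  \<open>T\<close> is the translation by (0, a), which moves one centre to the other and commutes
  with turning about it.\<close>

lemma fiber_shift_conjugates_rad_flow:
  fixes q a :: "'e::euclidean_space" and y :: "'e \<times> 'e"
  assumes "0 < r" "r < R"
  defines "T \<equiv> fiber_shift (linear_bump r R q a) 1"
  shows "T (rad_flow r (q, 0) 1 y) = rad_flow r (q, a) 1 (T y)"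
proof -
  have T_ball: "T y = y + (0, a)" if "fst y \<in> ball q r" for y
    unfolding T_def fiber_shift_def using linear_bump(3)[OF assms(1,2) that]
    by (simp add: prod_eq_iff)
  have T_fst: "fst (T y) = fst y" for y by (simp add: T_def fiber_shift_def)
  have sq: "fst x \<in> ball q r" if "(x - (q, b)) \<bullet> (x - (q, b)) < r\<^sup>2" for x and b :: 'e
    using sq_le_inner_of_fst[of r x "(q, b)"] that assms(1) by (force simp: dist_commute)
  show ?thesis
  proof (cases "(y - (q, 0)) \<bullet> (y - (q, 0)) < r\<^sup>2")
    case True
    have eq: "y + (0, a) - (q, a) = y - (q, 0)" by (simp add: prod_eq_iff)
    have "(rad_flow r (q, 0) 1 y - (q, 0)) \<bullet> (rad_flow r (q, 0) 1 y - (q, 0)) < r\<^sup>2"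
      using True by (simp add: rad_flow_def inner_rot)
    then have "T (rad_flow r (q, 0) 1 y) = rad_flow r (q, 0) 1 y + (0, a)"
      using T_ball sq by blast
    also have "\<dots> = rad_flow r (q, a) 1 (y + (0, a))"
      unfolding rad_flow_def speed_def eq by (simp add: prod_eq_iff)
    finally show ?thesis using T_ball[OF sq[OF True]] by simp
  next
    case False
    \<comment> \<open>Also \<open>T y\<close> must avoid the second ball. Otherwise its base point,
      which is that of \<open>y\<close>, would lie in \<open>ball q r\<close>, \<open>T\<close>
      would translate there, and \<open>y\<close> would lie in the first ball.\<close>
    have "\<not> (T y - (q, a)) \<bullet> (T y - (q, a)) < r\<^sup>2"
    proof
      assume less: "(T y - (q, a)) \<bullet> (T y - (q, a)) < r\<^sup>2"
      then have "T y = y + (0, a)" using sq T_fst T_ball by metis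
      then have "T y - (q, a) = y - (q, 0)" by (simp add: prod_eq_iff)
      then show False using less False by simp
    qed
    then show ?thesis using False by (simp add: rad_flow_outside not_less)
  qed
qed

section \<open>Displacing the support to infinity\<close>

lemma (in charted) compactin_cinv_image:
  assumes "c \<in> atlas M" "compact B" "B \<subseteq> snd c ` fst c"
  shows "compactin (mtop M) (cinv c ` B)"
proof (rule image_compactin)
  show "compactin (top_of_set B) B" using assms(2) by (simp add: compactin_subtopology)
  show "continuous_map (top_of_set B) (mtop M) (cinv c)"
    unfolding continuous_map_def
  proof (intro conjI allI impI)
    show "cinv c \<in> topspace (top_of_set B) \<rightarrow> topspace (mtop M)"
      using cinv_in[of _ c] assms dom_subset by fastforce
    fix A assume A: "openin (mtop M) A"
    have "{y \<in> topspace (top_of_set B). cinv c y \<in> A} = B \<inter> snd c ` (fst c \<inter> A)"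
    proof (intro equalityI subsetI)
      fix y assume y: "y \<in> {y \<in> topspace (top_of_set B). cinv c y \<in> A}"
      then have "y \<in> snd c ` fst c" using assms(3) by auto
      then show "y \<in> B \<inter> snd c ` (fst c \<inter> A)"
        using y cinv_in[of y c] chart_cinv[of y c] by (intro IntI image_eqI[of y _ "cinv c y"]) simp_all
    qed (use cinv_chart[OF assms(1)] in auto)
    then show "openin (top_of_set B) {y \<in> topspace (top_of_set B). cinv c y \<in> A}"
      using open_chart_image[OF assms(1) A] by (simp add: openin_open_Int)
  qed
qed

text \<open>The inverse chart maps a compact set to a compact set, which is closed in N by the
  Hausdorff property.\<close>

lemma supported_in_chart_compact:
  assumes "smooth_manifold N" "c \<in> atlas N" "compact B" "B \<subseteq> snd c ` fst c"
  shows "supported_in_chart N c B"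
proof -
  interpret charted N by (rule charted_smooth_manifold[OF assms(1)])
  have "closedin (mtop N) (cinv c ` B)"
    using compactin_imp_closedin compactin_cinv_image[OF assms(2-4)] assms(1)
    unfolding smooth_manifold_def by blast
  then show ?thesis
    by unfold_locales (use assms in \<open>auto simp: closedin_def\<close>)
qed

context supported_in_chart
begin

text \<open>On the part of K outside \<open>Out\<close> the momentum is bounded by some M, while the
  centre has momentum of norm n; once n is at least M + r, the ball around it is missed.\<close>

lemma rad_supports_leave_compacts:
  assumes "compactin (mtop TN) K" "norm e = 1" "ball q r \<subseteq> B" "r > 0"
  shows "\<forall>\<^sub>F n in sequentially. \<forall>z\<in>K. lift_fun (rad_h r (q, real n *\<^sub>R e)) z = 0"
proof -
  \<comment> \<open>An open cover: over the complement of \<open>B\<close> nothing is asked,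
    elsewhere the momentum is less than m. A bound on the indices of a finite subcover is the
    required M.\<close>
  define U where "U m = Out \<union> {z \<in> Dom. snd (CC c) z \<in> UNIV \<times> ball 0 (real m)}" for m :: nat
  have op: "\<forall>A\<in>range U. openin (mtop TN) A"
    unfolding U_def
    by (intro ballI, elim imageE, simp only:, intro openin_Un openin_Out T.openin_chart_vimage[OF CC_atlas])
      (simp add: open_Times)
  have "K \<subseteq> \<Union>(range U)"
  proof
    fix z assume "z \<in> K"
    then have "z \<in> pts TN" using assms(1) compactin_subset_topspace by blast
    moreover obtain m where "norm (snd (snd (CC c) z)) < real m" using reals_Archimedean2 by blast
    ultimately have "z \<in> U m" using Dom_Out[of z] by (auto simp: U_def mem_Times_iff)
    then show "z \<in> \<Union>(range U)" by blast
  qed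
  then obtain \<F> where F: "finite \<F>" "\<F> \<subseteq> range U" "K \<subseteq> \<Union>\<F>"
    using assms(1) op unfolding compactin_def by meson
  then obtain I where I: "finite I" "\<F> = U ` I" using finite_subset_image by metis
  obtain M where M: "\<And>i. i \<in> I \<Longrightarrow> i \<le> M"
    using I(1) finite_nat_set_iff_bounded_le[of I] by blast
  have "lift_fun (rad_h r (q, real n *\<^sub>R e)) z = 0" if n: "real n \<ge> real M + r" and z: "z \<in> K" for n z
  proof (cases "z \<in> Dom")
    case True
    let ?y = "snd (CC c) z" and ?p = "(q, real n *\<^sub>R e)"
    obtain m where m: "z \<in> U m" "m \<le> M" using z F I M by blast
    have "r\<^sup>2 \<le> (?y - ?p) \<bullet> (?y - ?p)"
    proof (cases "z \<in> Out")
      case True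
      then have "fst ?y \<notin> ball q r" using Out_fst[OF \<open>z \<in> Dom\<close>] assms(3) by blast
      then show ?thesis using assms(4) by (intro sq_le_inner_of_fst) (auto simp: dist_commute)
    next
      case False
      then have "norm (snd ?y) < real m" using m by (auto simp: U_def mem_Times_iff)
      then have "norm (snd ?y) \<le> real M" using m(2) by linarith
      moreover have "norm (real n *\<^sub>R e) = real n" using assms(2) by simp
      ultimately have "r \<le> norm (snd ?y - real n *\<^sub>R e)"
        using n norm_triangle_ineq2[of "real n *\<^sub>R e" "snd ?y"]
          norm_minus_commute[of "snd ?y" "real n *\<^sub>R e"] by linarith
      then have "r\<^sup>2 \<le> (norm (snd (?y - ?p)))\<^sup>2" using assms(4) by (intro power_mono) auto
      also have "\<dots> \<le> (?y - ?p) \<bullet> (?y - ?p)" by (simp add: inner_prod_def power2_norm_eq_inner)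
      finally show ?thesis .
    qed
    then show ?thesis by (simp add: lift_fun_def rad_flow_outside)
  qed (simp add: lift_fun_def)
  moreover have "\<forall>\<^sub>F n in sequentially. real n \<ge> real M + r"
    using filterlim_real_sequentially by (simp add: filterlim_at_top)
  ultimately show ?thesis by (auto elim: eventually_mono)
qed

end

section \<open>Convergence in the compact-open topology and the contradiction\<close>

text \<open>It suffices to test generators. A compact K in the product with the time interval
  projects to a compact set of M, on which the functions eventually equal the limit exactly.\<close>

lemma limitin_ham_topology_0:
  assumes "(\<lambda>_ _. 0) \<in> Ham M \<omega>" "\<And>n. (\<lambda>_. F n) \<in> Ham M \<omega>"
    "\<And>K. compactin (mtop M) K \<Longrightarrow> \<forall>\<^sub>F n in sequentially. \<forall>x\<in>K. F n x = 0"
  shows "limitin (ham_topology M \<omega>) (\<lambda>n _. F n) (\<lambda>_ _. 0) sequentially"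
proof -
  define S where "S = {{H \<in> Ham M \<omega>. \<forall>(t, x)\<in>K. H t x \<in> V} | K V.
        compactin (prod_topology (top_of_set {0..1}) (mtop M)) K \<and> open V}"
  have top: "ham_topology M \<omega> = topology_generated_by S"
    by (simp add: ham_topology_def S_def)
  \<comment> \<open>The empty compact set gives the generator \<open>Ham M \<omega>\<close>, so
    every element of \<open>Ham\<close> is a point of the topology.\<close>
  have "{H \<in> Ham M \<omega>. \<forall>(t, x)\<in>{}. H t x \<in> (UNIV :: real set)} \<in> S"
    unfolding S_def using compactin_empty open_UNIV by blast
  then have in_top: "(\<lambda>_ _. 0) \<in> topspace (ham_topology M \<omega>)"
    using assms(1) unfolding top topology_generated_by_topspace by blast
  have "\<forall>\<^sub>F n in sequentially. (\<lambda>_. F n) \<in> U"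
    if "openin (ham_topology M \<omega>) U" "(\<lambda>_ _. 0) \<in> U" for U
  proof -
    have "generate_topology_on S U" using that(1) by (simp add: top openin_topology_generated_by)
    then show ?thesis using that(2)
    proof induction
      case Empty
      then show ?case by simp
    next
      case (Int a b)
      then show ?case by (auto intro: eventually_conj)
    next
      case (UN K)
      then obtain k where "k \<in> K" "(\<lambda>_ _. 0) \<in> k" by blast
      then have "\<forall>\<^sub>F n in sequentially. (\<lambda>_. F n) \<in> k" by (rule UN.IH)
      then show ?case by (rule eventually_mono) (use \<open>k \<in> K\<close> in blast)
    next
      case (Basis s)
      then obtain K V where K: "compactin (prod_topology (top_of_set {0..1}) (mtop M)) K"
        and s: "s = {H \<in> Ham M \<omega>. \<forall>(t, x)\<in>K. H t x \<in> V}" unfolding S_def by blast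
      \<comment> \<open>Membership of the limit says something about V only when K is
        nonempty.\<close>
      have V: "0 \<in> V" if "K \<noteq> {}" using Basis.prems that unfolding s by auto
      have "compactin (mtop M) (snd ` K)" by (rule image_compactin[OF K continuous_map_snd])
      from assms(3)[OF this] show ?case
      proof (rule eventually_mono)
        fix n assume F: "\<forall>x\<in>snd ` K. F n x = 0"
        show "(\<lambda>_. F n) \<in> s" unfolding s using assms(2) F V by fastforce
      qed
    qed
  qed
  then show ?thesis using in_top by (simp add: limitin_def)
qed

theorem corollary6:
  fixes N :: "('a, 'e::euclidean_space) mfd"
  assumes "smooth_manifold N" and "pts N \<noteq> {}" and "DIM('e) \<ge> 2"
  shows "\<nexists>d.
    bi_invariant_metric
      (ham_diffeos (cotangent_bundle N) (canonical_symplectic_form N)) d \<and>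
    C_minus_1 (cotangent_bundle N) (canonical_symplectic_form N)
      (ham_diffeos (cotangent_bundle N) (canonical_symplectic_form N)) d"
proof
  let ?M = "cotangent_bundle N" and ?\<omega> = "canonical_symplectic_form N"
  let ?G = "ham_diffeos ?M ?\<omega>"
  assume "\<exists>d. bi_invariant_metric ?G d \<and> C_minus_1 ?M ?\<omega> ?G d"
  then obtain d where bi: "bi_invariant_metric ?G d" and C: "C_minus_1 ?M ?\<omega> ?G d" by blast
  interpret N: charted N by (rule charted_smooth_manifold[OF assms(1)])
  obtain x c where c: "c \<in> atlas N" "x \<in> fst c" using assms(2) N.ex_chart by blast
  define q where "q = snd c x"
  obtain R where R: "R > 0" "cball q R \<subseteq> snd c ` fst c"
    using N.open_image[OF c(1)] c(2) open_contains_cball unfolding q_def by blast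
  \<comment> \<open>The annulus between r and R is where \<open>linear_bump\<close> falls to 0,
    while it stays linear over the support of the radial Hamiltonian.\<close>
  define r where "r = R / 2"
  have r: "0 < r" "r < R" using R(1) by (simp_all add: r_def)
  define B where "B = cball q R"
  have B: "ball q r \<subseteq> B" using r by (auto simp: B_def)
  have supp: "supported_in_chart N c B"
    by (rule supported_in_chart_compact[OF assms(1) c(1)]) (use R in \<open>auto simp: B_def\<close>)
  interpret supported_in_chart N c B by (rule supp)
  obtain e :: 'e where e: "e \<in> Basis" using nonempty_Basis by blast
  define p where "p n = (q, real n *\<^sub>R e)" for n :: nat
  define f where "f n = linear_bump r R q (real n *\<^sub>R e)" for n :: nat
  define \<phi> where "\<phi> n = lift (rad_flow r (p n) 1)" for n
  define \<eta> where "\<eta> n = lift (fiber_shift (f n) 1)" for n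
  have p0: "p 0 = (q, 0)" by (simp add: p_def)
  have rad: "chart_flow N c B (rad_h r (p n)) (\<lambda>y. speed r (p n) y *\<^sub>R (y - p n)) (rad_flow r (p n))" for n
    by (rule rad_chart_flow[OF supp _ r(1)]) (use B in \<open>simp add: p_def\<close>)
  have shift: "chart_flow N c B (\<lambda>y. - f n (fst y)) (\<lambda>y. (- gradient (f n) (fst y), 0)) (fiber_shift (f n))" for n
    unfolding f_def using linear_bump[OF r]
    by (intro fiber_shift_chart_flow[OF supp]) (auto simp: B_def)
  note zero = ident_chart_flow[OF supp]
  have H0: "(\<lambda>_. lift_fun (\<lambda>_. 0)) = (\<lambda>_ _. 0)" "lift (\<lambda>y. y) = id"
    by (simp_all add: fun_eq_iff lift_fun_def lift_ident)
  have zero_Ham: "(\<lambda>_ _. 0) \<in> Ham ?M ?\<omega>" "ham_map ?M ?\<omega> (\<lambda>_ _. 0) = id"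
    using chart_flow.H_in_Ham[OF zero] chart_flow.ham_map_H[OF zero] by (simp_all add: H0)
  have rad_Ham: "(\<lambda>_. lift_fun (rad_h r (p n))) \<in> Ham ?M ?\<omega>"
      "ham_map ?M ?\<omega> (\<lambda>_. lift_fun (rad_h r (p n))) = \<phi> n" for n
    using chart_flow.H_in_Ham[OF rad] chart_flow.ham_map_H[OF rad] by (simp_all add: \<phi>_def)
  have in_G: "id \<in> ?G" "\<phi> n \<in> ?G" "\<eta> n \<in> ?G" for n
    using chart_flow.lift_in_ham_diffeos[OF zero] chart_flow.lift_in_ham_diffeos[OF rad]
      chart_flow.lift_in_ham_diffeos[OF shift] by (simp_all add: H0 \<phi>_def \<eta>_def)
  have conj: "\<eta> n \<circ> \<phi> 0 = \<phi> n \<circ> \<eta> n" for n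
  proof
    fix z
    have "lift (\<lambda>y. fiber_shift (f n) 1 (rad_flow r (p 0) 1 y)) z =
        lift (\<lambda>y. rad_flow r (p n) 1 (fiber_shift (f n) 1 y)) z"
      using fiber_shift_conjugates_rad_flow[OF r, of q "real n *\<^sub>R e"] by (simp add: f_def p_def)
    then show "(\<eta> n \<circ> \<phi> 0) z = (\<phi> n \<circ> \<eta> n) z"
      by (simp add: \<eta>_def \<phi>_def lift_lift chart_flow.flow_supported[OF rad]
          chart_flow.flow_supported[OF shift])
  qed
  \<comment> \<open>One translation on each side, without inverses: d(id, \<phi>_n) = d(\<eta>_n,
    \<phi>_n \<eta>_n) = d(\<eta>_n, \<eta>_n \<phi>_0) = d(id, \<phi>_0).\<close>
  have const: "d id (\<phi> n) = d id (\<phi> 0)" for n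
  proof -
    have inv: "d \<alpha> \<beta> = d (\<alpha> \<circ> \<xi>) (\<beta> \<circ> \<xi>)" "d \<alpha> \<beta> = d (\<xi> \<circ> \<alpha>) (\<xi> \<circ> \<beta>)"
      if "\<alpha> \<in> ?G" "\<beta> \<in> ?G" "\<xi> \<in> ?G" for \<alpha> \<beta> \<xi>
      using bi that unfolding bi_invariant_metric_def by blast+
    have "d id (\<phi> n) = d (\<eta> n) (\<phi> n \<circ> \<eta> n)" using inv(1)[of id "\<phi> n" "\<eta> n"] in_G by simp
    also have "\<dots> = d id (\<phi> 0)" using inv(2)[of id "\<phi> 0" "\<eta> n"] in_G by (simp add: conj)
    finally show ?thesis .
  qed
  let ?F = "\<lambda>(H, K). d (ham_map ?M ?\<omega> H) (ham_map ?M ?\<omega> K)"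
  define S where "S = {H \<in> Ham ?M ?\<omega>. ham_map ?M ?\<omega> H \<in> ?G}"
  define T where "T = subtopology (ham_topology ?M ?\<omega>) S"
  have cont: "continuous_map (prod_topology T T) euclideanreal ?F"
    using C unfolding C_minus_1_def Let_def T_def S_def .
  have in_S: "(\<lambda>_ _. 0) \<in> S" "(\<lambda>_. lift_fun (rad_h r (p n))) \<in> S" for n
    unfolding S_def using zero_Ham rad_Ham in_G by auto
  have "\<forall>\<^sub>F n in sequentially. \<forall>z\<in>K. lift_fun (rad_h r (p n)) z = 0"
    if "compactin (mtop ?M) K" for K
    unfolding p_def by (rule rad_supports_leave_compacts[OF that _ B r(1)]) (use e in simp)
  then have "limitin (ham_topology ?M ?\<omega>) (\<lambda>n _. lift_fun (rad_h r (p n))) (\<lambda>_ _. 0) sequentially"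
    by (intro limitin_ham_topology_0 zero_Ham rad_Ham)
  then have lim: "limitin T (\<lambda>n _. lift_fun (rad_h r (p n))) (\<lambda>_ _. 0) sequentially"
    unfolding T_def limitin_subtopology using in_S by simp
  have lim0: "limitin T (\<lambda>n _ _. 0) (\<lambda>_ _. 0) sequentially"
    using limitin_topspace[OF lim] by (simp add: limitin_def)
  \<comment> \<open>The first slot stays at the zero Hamiltonian, whose time-one map is the
    identity.\<close>
  have "limitin (prod_topology T T) (\<lambda>n. (\<lambda>_ _. 0, \<lambda>_. lift_fun (rad_h r (p n))))
      (\<lambda>_ _. 0, \<lambda>_ _. 0) sequentially"
    unfolding limitin_pairwise o_def fst_conv snd_conv using lim lim0 by blast
  from continuous_map_limit[OF cont this]
  have "(\<lambda>n. d id (\<phi> n)) \<longlonglongrightarrow> d id id" by (simp add: o_def zero_Ham rad_Ham)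
  moreover have "(\<lambda>n. d id (\<phi> n)) = (\<lambda>n. d id (\<phi> 0))" by (rule ext) (rule const)
  ultimately have "d id (\<phi> 0) = d id id" by (simp add: LIMSEQ_const_iff)
  moreover have met: "Metric_space ?G d" using bi unfolding bi_invariant_metric_def by blast
  ultimately have "\<phi> 0 = id"
    using in_G Metric_space.zero[OF met] by metis
  moreover have "\<phi> 0 \<noteq> id"
  proof
    assume "\<phi> 0 = id"
    \<comment> \<open>A point strictly between the centre, which every rotation fixes, and the
      boundary, from which on the flow is trivial.\<close>
    define y where "y = (q + (r / 2) *\<^sub>R e, 0 :: 'e)"
    have "fst y \<in> B" using r e by (simp add: y_def B_def dist_norm)
    then have "y \<in> snd (CC c) ` Dom" using B_sub by (auto simp: CC_image_dom[OF c(1)] mem_Times_iff)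
    then obtain z where z: "z \<in> Dom" "y = snd (CC c) z" by blast
    have "rad_flow r (p 0) 1 y = y"
      using lift_Dom(2)[OF chart_flow.flow_supported[OF rad] z(1), of 0 1] \<open>\<phi> 0 = id\<close> z
      by (simp add: \<phi>_def)
    moreover have "rad_flow r (p 0) 1 y \<noteq> y"
    proof (rule rad_flow_moves)
      show "y \<noteq> p 0" using r e nonzero_Basis by (auto simp: y_def p_def)
      have "(y - p 0) \<bullet> (y - p 0) = (r / 2)\<^sup>2"
        using e by (simp add: y_def p_def inner_prod_def power2_eq_square inner_Basis)
      also have "\<dots> < r\<^sup>2" using r by (intro power_strict_mono) auto
      finally show "(y - p 0) \<bullet> (y - p 0) < r\<^sup>2" .
    qed
    ultimately show False by contradiction
  qed
  ultimately show False by contradiction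
qed

end
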